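(* Let $p\in(1,\infty)$ and let $\mu$ be a probability measure on $\mathbb{R}^N$ for which there exist constants $C,D\in(0,\infty)$ such that $$\int|f|\,d^{p-1}\,d\mu\le C\int|\nabla f|\,d\mu+D\int|f|\,d\mu\qquad\text{for all }f\in\mathcal{L}.$$ Then for each $q\in[1,\infty)$ there exist constants $C_q,D_q\in(0,\infty)$ such that for every $f\in\mathcal{L}$ $$\int|f|^q d^{q(p-1)}\,d\mu\le C_q\int|\nabla f|^q\,d\mu+D_q\int|f|^q\,d\mu .$$
   Context: Setting. $\nabla=(X_1,\dots,X_k)$ is a finite collection of smooth, possibly noncommuting, vector fields on $\mathbb{R}^N$, each with zero divergence with respect to Lebesgue measure $\lambda$; $\nabla f=(X_1f,\dots,X_kf)$ and $|\nabla f|=(\sum_i (X_if)^2)^{1/2}$. $\mathcal{L}$ denotes the class of continuous functions $f:\mathbb{R}^N\to\mathbb{R}$ whose distributional derivatives $X_if$ are all in $L^\infty_{loc}$. $d:\mathbb{R}^N\to[0,\infty)$ is the distance from a fixed point (the origin) in some metric; it is assumed that $d\in\mathcal{L}$, that $|\nabla d|\le1$ almost everywhere, and that the balls $\{d\le R\}$ are compact. $\mu$ is absolutely continuous with respect to $\lambda$. Integrals on the right-hand side are allowed to be $+\infty$. *)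

theory Defs
  imports "HOL-Probability.Probability"
begin

primrec Ck :: "nat \<Rightarrow> (real ^ 'n \<Rightarrow> 'b::real_normed_vector) \<Rightarrow> bool" where
  "Ck 0 f \<longleftrightarrow> continuous_on UNIV f"
| "Ck (Suc m) f \<longleftrightarrow>
     (\<forall>x. f differentiable (at x)) \<and> (\<forall>v. Ck m (\<lambda>x. frechet_derivative f (at x) v))"

definition smooth :: "(real ^ 'n \<Rightarrow> 'b::real_normed_vector) \<Rightarrow> bool" where
  "smooth f \<longleftrightarrow> (\<forall>m. Ck m f)"

definition test_function :: "(real ^ 'n \<Rightarrow> real) \<Rightarrow> bool" where
  "test_function \<phi> \<longleftrightarrow> smooth \<phi> \<and> compact (closure {x. \<phi> x \<noteq> 0})"

text \<open>A vector field is identified with its coefficient function \<open>V\<close>; it acts on a differentiable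
  function as the derivation \<open>\<Sum>\<^sub>j V\<^sub>j \<partial>\<^sub>j\<close>.\<close>

definition apply_field :: "(real ^ 'n \<Rightarrow> real ^ 'n) \<Rightarrow> (real ^ 'n \<Rightarrow> real) \<Rightarrow> real ^ 'n \<Rightarrow> real" where
  "apply_field V \<phi> x = frechet_derivative \<phi> (at x) (V x)"

definition divergence :: "(real ^ 'n \<Rightarrow> real ^ 'n) \<Rightarrow> real ^ 'n \<Rightarrow> real" where
  "divergence V x = (\<Sum>j\<in>UNIV. frechet_derivative V (at x) (axis j 1) $ j)"

text \<open>Borel measurable and essentially bounded on every compact set. Asking for Borel rather than
  Lebesgue measurability only restricts the choice of representative.\<close>

definition Linf_loc :: "(real ^ 'n \<Rightarrow> real) \<Rightarrow> bool" where
  "Linf_loc g \<longleftrightarrow> g \<in> borel_measurable borel \<and>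
     (\<forall>K. compact K \<longrightarrow> (\<exists>B. AE x in lborel. x \<in> K \<longrightarrow> \<bar>g x\<bar> \<le> B))"

text \<open>\<open>V f = g\<close> in the sense of distributions. The formal adjoint of \<open>V\<close> with respect to Lebesgue
  measure is \<open>\<phi> \<mapsto> - V \<phi> - (div V) \<phi>\<close>, i.e. \<open>- V\<close> for a divergence-free field.\<close>

definition distributional_deriv ::
    "(real ^ 'n \<Rightarrow> real ^ 'n) \<Rightarrow> (real ^ 'n \<Rightarrow> real) \<Rightarrow> (real ^ 'n \<Rightarrow> real) \<Rightarrow> bool" where
  "distributional_deriv V f g \<longleftrightarrow> (\<forall>\<phi>. test_function \<phi> \<longrightarrow>
     (\<integral>x. g x * \<phi> x \<partial>lborel) =
     (\<integral>x. f x * (- apply_field V \<phi> x - divergence V x * \<phi> x) \<partial>lborel))"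

text \<open>\<open>G\<close> is a representative of \<open>\<nabla>f = (X\<^sub>1 f, \<dots>, X\<^sub>k f)\<close>, the finite type \<open>'k\<close> indexing the fields.
  The distributional gradient is only determined up to Lebesgue-null sets, hence a relation. The
  Euclidean norm of \<open>G x\<close> is \<open>|\<nabla>f|(x)\<close>.\<close>

definition has_gradient ::
    "('k::finite \<Rightarrow> real ^ 'n \<Rightarrow> real ^ 'n) \<Rightarrow> (real ^ 'n \<Rightarrow> real) \<Rightarrow> (real ^ 'n \<Rightarrow> real ^ 'k) \<Rightarrow> bool"
  where
  "has_gradient X f G \<longleftrightarrow>
     (\<forall>i. Linf_loc (\<lambda>x. G x $ i) \<and> distributional_deriv (X i) f (\<lambda>x. G x $ i))"

definition class_L :: "('k::finite \<Rightarrow> real ^ 'n \<Rightarrow> real ^ 'n) \<Rightarrow> (real ^ 'n \<Rightarrow> real) set" where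
  "class_L X = {f. continuous_on UNIV f \<and> (\<exists>G. has_gradient X f G)}"

end

theory Submission
  imports Defs "HOL-Real_Asymp.Real_Asymp"
begin

text \<open>The hypothesis is applied to \<open>|f|\<^sup>q (1 + d\<^sup>2)\<^sup>b\<close> with \<open>2 b = (q - 1) (p - 1)\<close>; the smooth weight
  replaces \<open>d powr (2 b)\<close>, whose derivative may blow up where \<open>d = 0\<close>. Since \<open>|\<nabla>d| \<le> 1\<close>, Young's
  inequality bounds the right-hand side by half of the left-hand side plus multiples of
  \<open>\<integral>|\<nabla>f|\<^sup>q d\<mu>\<close> and \<open>\<integral>|f|\<^sup>q d\<mu>\<close>, and the first term can be absorbed when \<open>f\<close> vanishes outside a
  ball, because the left-hand side is then finite. Multiplying \<open>f\<close> by cutoff functions of \<open>d\<close> and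
  monotone convergence give the general case.

  The calculus this needs is that \<open>\<L>\<close> is stable under products and composition with \<open>C\<^sup>1\<close>
  functions. The product rule is proved by doubling of variables with a mollifier: the error is a
  commutator which tends to \<open>0\<close> because \<open>f\<close> and \<open>g\<close> are continuous and the fields are Lipschitz and
  divergence free. It gives the chain rule for polynomials, and the Weierstrass approximation theorem,
  applied to the derivative, gives it for \<open>C\<^sup>1\<close> functions.\<close>

section \<open>Smooth functions\<close>

text \<open>The fields may be degenerate, so a member of the class need not be differentiable at any
  point, and their coefficients vary, so mollifying does not commute with \<open>X i\<close>. Hence
  every calculus rule is proved in integrated form against test functions. The dangerous commutator
  term pairs the derivative of the mollifier, larger than the mollifier by a factor of order
  \<open>1/\<epsilon>\<close>, with \<open>V x - V y\<close>; the Lipschitz bound cancels that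
  factor, and the increment \<open>f x - f y\<close> then makes the term small.

  The exponent \<open>2 b = (q - 1) a\<close> with \<open>a = p - 1\<close> has two effects. On the
  left, the factor \<open>d powr a\<close> completes the weight to at least
  \<open>d powr (q * a)\<close>. On the right, the weight is \<open>s powr (q - 1)\<close> for
  \<open>s = (1 + d^2) powr (a / 2)\<close>, so both terms have the form
  \<open>(|f| s) powr (q - 1)\<close> times \<open>|\<nabla>f|\<close> or \<open>|f|\<close>, the
  shape required by Young's inequality, and \<open>s powr q\<close> is at most a multiple of
  \<open>1 + d powr (q * a)\<close>.

  The constants obtained for a compactly supported \<open>f\<close> must not depend on the radius of
  its support; otherwise the cutoffs could not be removed.\<close>

lemma Ck_Suc_imp: "Ck (Suc m) f \<Longrightarrow> Ck m f"
proof (induction m arbitrary: f)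
  case 0
  then have "\<forall>x. f differentiable (at x)" by simp
  then show ?case
    by (auto intro!: continuous_at_imp_continuous_on differentiable_imp_continuous_within)
next
  case (Suc m)
  then show ?case by (metis Ck.simps(2))
qed

lemma frechet_derivative_eqI: "(f has_derivative f') (at x) \<Longrightarrow> frechet_derivative f (at x) = f'"
  using frechet_derivative_at by metis

lemma Ck_add:
  assumes "Ck m f" "Ck m g" shows "Ck m (\<lambda>x. f x + g x)"
  using assms
proof (induction m arbitrary: f g)
  case 0
  then show ?case by (auto intro!: continuous_intros)
next
  case (Suc m)
  have "frechet_derivative (\<lambda>x. f x + g x) (at x) =
      (\<lambda>v. frechet_derivative f (at x) v + frechet_derivative g (at x) v)" for x
    using Suc.prems
    by (intro frechet_derivative_eqI has_derivative_add) (auto simp: frechet_derivative_works[symmetric])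
  with Suc show ?case by simp
qed

lemma frechet_derivative_mult:
  fixes f g :: "'a::real_normed_vector \<Rightarrow> real"
  assumes "f differentiable at x" "g differentiable at x"
  shows "frechet_derivative (\<lambda>x. f x * g x) (at x) v =
      f x * frechet_derivative g (at x) v + frechet_derivative f (at x) v * g x"
proof -
  have "((\<lambda>x. f x * g x) has_derivative (\<lambda>v. f x * frechet_derivative g (at x) v
      + frechet_derivative f (at x) v * g x)) (at x)"
    using assms by (intro has_derivative_mult) (auto simp: frechet_derivative_works[symmetric])
  then show ?thesis
    using frechet_derivative_eqI by fastforce
qed

lemma Ck_mult:
  fixes f g :: "real ^ 'n \<Rightarrow> real"
  assumes "Ck m f" "Ck m g" shows "Ck m (\<lambda>x. f x * g x)"
  using assms
proof (induction m arbitrary: f g)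
  case 0
  then show ?case by (auto intro!: continuous_intros)
next
  case (Suc m)
  have "(\<lambda>x. frechet_derivative (\<lambda>x. f x * g x) (at x) v) =
      (\<lambda>x. f x * frechet_derivative g (at x) v + frechet_derivative f (at x) v * g x)" for v
    using Suc.prems by (auto simp: frechet_derivative_mult)
  moreover have "Ck m f" "Ck m g" using Suc.prems Ck_Suc_imp by blast+
  ultimately show ?case using Suc by (auto intro!: Ck_add differentiable_mult)
qed

lemma smooth_mult:
  fixes f g :: "real ^ 'n \<Rightarrow> real"
  shows "smooth f \<Longrightarrow> smooth g \<Longrightarrow> smooth (\<lambda>x. f x * g x)"
  by (simp add: smooth_def Ck_mult)

text \<open>The induction on the order has to pass from a function to all its directional
  derivatives, so it runs over a whole class closed under them rather than over a single
  function.\<close>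

lemma smooth_coinduct:
  assumes "f \<in> S" and "\<And>f x. f \<in> S \<Longrightarrow> f differentiable (at x)"
    and "\<And>f v. f \<in> S \<Longrightarrow> (\<lambda>x. frechet_derivative f (at x) v) \<in> S"
  shows "smooth f"
proof -
  have "\<forall>f\<in>S. Ck m f" for m
  proof (induction m)
    case 0
    show ?case
      using assms(2) by (auto intro!: continuous_at_imp_continuous_on differentiable_imp_continuous_within)
  next
    case (Suc m)
    then show ?case using assms(2,3) by auto
  qed
  then show ?thesis using assms(1) by (auto simp: smooth_def)
qed

section \<open>A family of bump functions closed under differentiation\<close>

definition flat :: "nat \<Rightarrow> real \<Rightarrow> real" where
  "flat k t = (if t \<le> 0 then 0 else exp (- inverse t) * inverse t ^ k)"

lemma flat_nonneg: "flat k t \<ge> 0"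
  by (simp add: flat_def)

text \<open>Each derivative of \<open>exp (- 1/t)\<close> brings down powers of \<open>1/t\<close>;
  carrying the power \<open>k\<close> as an index keeps all derivatives in the span of the family.
  At \<open>0\<close> the exponential beats every power, so the one-sided quotients both tend to
  \<open>0\<close>.\<close>

lemma flat_has_derivative:
  "(flat k has_real_derivative flat (k + 2) t - k * flat (k + 1) t) (at t)"
proof -
  consider "t < 0" | "t = 0" | "t > 0" by linarith
  then show ?thesis
  proof cases
    case 1
    have "((\<lambda>_. 0) has_real_derivative 0) (at t)" by simp
    then have "(flat k has_real_derivative 0) (at t)"
      by (rule has_field_derivative_transform_within_open[where S="{..<0}"]) (use 1 in \<open>auto simp: flat_def\<close>)
    then show ?thesis using 1 by (simp add: flat_def)
  next
    case 2
    have l: "((\<lambda>h. flat k h / h) \<longlongrightarrow> 0) (at_left 0)"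
      by (rule tendsto_eventually) (auto simp: eventually_at_filter flat_def)
    have "((\<lambda>h::real. exp (- inverse h) * inverse h ^ k / h) \<longlongrightarrow> 0) (at_right 0)"
      by real_asymp
    then have r: "((\<lambda>h. flat k h / h) \<longlongrightarrow> 0) (at_right 0)"
      by (rule Lim_transform_eventually) (auto simp: eventually_at_filter flat_def)
    have "(flat k has_real_derivative 0) (at 0)"
      unfolding DERIV_def using filterlim_split_at[OF l r] by (simp add: flat_def)
    then show ?thesis using 2 by (simp add: flat_def)
  next
    case 3
    have "((\<lambda>t. exp (- inverse t) * inverse t ^ k) has_real_derivative
        flat (k + 2) t - k * flat (k + 1) t) (at t)"
    proof -
      have s: "(inverse has_real_derivative - (inverse t ^ 2)) (at t)"
        using DERIV_inverse[of t] 3 by (simp add: power2_eq_square)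
      have "((\<lambda>t. exp (- inverse t) * inverse t ^ k) has_real_derivative
          exp (- inverse t) * - (- (inverse t ^ 2)) * inverse t ^ k
          + (real k * (- (inverse t ^ 2) * inverse t ^ (k - Suc 0))) * exp (- inverse t)) (at t)"
        by (rule DERIV_mult[OF DERIV_fun_exp[OF DERIV_minus[OF s]] DERIV_power[OF s, of k]])
      \<comment> \<open>For \<open>k = 0\<close> the truncated exponent \<open>k - Suc 0\<close> is
        harmless, because the factor \<open>real k\<close> vanishes; hence the case split on
        \<open>k\<close>.\<close>
      also have "exp (- inverse t) * - (- (inverse t ^ 2)) * inverse t ^ k
          + (real k * (- (inverse t ^ 2) * inverse t ^ (k - Suc 0))) * exp (- inverse t)
          = flat (k + 2) t - k * flat (k + 1) t"
        using 3 by (cases k) (simp_all add: flat_def algebra_simps power2_eq_square)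
      finally show ?thesis .
    qed
    then show ?thesis
      by (rule has_field_derivative_transform_within_open[where S="{0<..}"]) (use 3 in \<open>auto simp: flat_def\<close>)
  qed
qed

text \<open>The derivative of \<open>flat k (1 - c * (x \<bullet> x))\<close> in direction
  \<open>v\<close> contains the factor \<open>x \<bullet> v\<close>. With linear functions and
  constants among the generators, the algebra is closed under directional derivatives and
  \<open>smooth_coinduct\<close> applies to it.\<close>

inductive_set bump_algebra :: "real \<Rightarrow> (real ^ 'n \<Rightarrow> real) set" for c :: real where
  bump_algebra_flat: "(\<lambda>x. flat k (1 - c * (x \<bullet> x))) \<in> bump_algebra c"
| bump_algebra_const: "(\<lambda>x. a) \<in> bump_algebra c"
| bump_algebra_inner: "(\<lambda>x. x \<bullet> v) \<in> bump_algebra c"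
| bump_algebra_add: "f \<in> bump_algebra c \<Longrightarrow> g \<in> bump_algebra c \<Longrightarrow> (\<lambda>x. f x + g x) \<in> bump_algebra c"
| bump_algebra_mult: "f \<in> bump_algebra c \<Longrightarrow> g \<in> bump_algebra c \<Longrightarrow> (\<lambda>x. f x * g x) \<in> bump_algebra c"

lemma flat_inner_has_derivative:
  "((\<lambda>x::real ^ 'n. flat k (1 - c * (x \<bullet> x))) has_derivative
    (\<lambda>v. (flat (k + 2) (1 - c * (x \<bullet> x)) - k * flat (k + 1) (1 - c * (x \<bullet> x))) * (- 2 * c * (x \<bullet> v)))) (at x)"
proof -
  have "((\<lambda>x::real ^ 'n. 1 - c * (x \<bullet> x)) has_derivative (\<lambda>v. - 2 * c * (x \<bullet> v))) (at x)"
    by (auto intro!: derivative_eq_intros simp: inner_commute)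
  from DERIV_compose_FDERIV[OF flat_has_derivative this] show ?thesis
    by (simp add: mult.commute)
qed

lemma bump_algebra_derivative:
  fixes f :: "real ^ 'n \<Rightarrow> real"
  assumes "f \<in> bump_algebra c"
  shows "(\<forall>x. f differentiable (at x)) \<and> (\<forall>v. (\<lambda>x. frechet_derivative f (at x) v) \<in> bump_algebra c)"
  using assms
proof induction
  case (bump_algebra_flat k)
  have eq: "(\<lambda>x. frechet_derivative (\<lambda>x::real ^ 'n. flat k (1 - c * (x \<bullet> x))) (at x) v) =
     (\<lambda>x. (flat (k + 2) (1 - c * (x \<bullet> x)) + (- real k) * flat (k + 1) (1 - c * (x \<bullet> x))) * (- 2 * c * (x \<bullet> v)))" for v
    by (simp add: frechet_derivative_eqI[OF flat_inner_has_derivative] fun_eq_iff)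
  show ?case
    unfolding eq
  proof (intro conjI allI)
    show "(\<lambda>x::real ^ 'n. flat k (1 - c * (x \<bullet> x))) differentiable at x" for x
      using flat_inner_has_derivative differentiable_def by blast
  qed (intro bump_algebra.intros)
next
  case (bump_algebra_const a)
  then show ?case by (simp add: bump_algebra.bump_algebra_const)
next
  case (bump_algebra_inner v)
  have d: "((\<lambda>x. x \<bullet> v) has_derivative (\<lambda>w. w \<bullet> v)) (at x)" for x :: "real ^ 'n"
    by (auto intro!: derivative_eq_intros)
  show ?case
    unfolding frechet_derivative_eqI[OF d]
  proof (intro conjI allI)
    show "(\<lambda>x. x \<bullet> v) differentiable at x" for x :: "real ^ 'n"
      using d differentiable_def by blast
  qed (intro bump_algebra.intros)
next
  case (bump_algebra_add f g)
  have "frechet_derivative (\<lambda>x. f x + g x) (at x) =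
      (\<lambda>v. frechet_derivative f (at x) v + frechet_derivative g (at x) v)" for x
    using bump_algebra_add
    by (intro frechet_derivative_eqI has_derivative_add) (auto simp: frechet_derivative_works[symmetric])
  with bump_algebra_add show ?case by (auto intro!: bump_algebra.bump_algebra_add)
next
  case (bump_algebra_mult f g)
  then show ?case
    by (auto simp: frechet_derivative_mult intro!: bump_algebra.bump_algebra_add bump_algebra.bump_algebra_mult)
qed

lemma smooth_flat_inner: "smooth (\<lambda>x::real ^ 'n. flat k (1 - c * (x \<bullet> x)))"
  using bump_algebra_derivative
  by (intro smooth_coinduct[of _ "bump_algebra c"]) (auto intro: bump_algebra.bump_algebra_flat)

lemma frechet_derivative_translate:
  assumes "f differentiable (at (x - a))"
  shows "frechet_derivative (\<lambda>x. f (x - a)) (at x) = frechet_derivative f (at (x - a))"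
proof -
  have "((\<lambda>x. x - a) has_derivative (\<lambda>v. v)) (at x)"
    by (auto intro!: derivative_eq_intros)
  moreover have "(f has_derivative frechet_derivative f (at (x - a))) (at (x - a))"
    using assms by (simp add: frechet_derivative_works[symmetric])
  ultimately show ?thesis
    by (rule frechet_derivative_eqI[OF has_derivative_compose])
qed

lemma Ck_translate: "Ck m f \<Longrightarrow> Ck m (\<lambda>x. f (x - a))"
proof (induction m arbitrary: f)
  case 0
  then show ?case by (auto intro!: continuous_on_compose2[of UNIV f] continuous_intros)
next
  case (Suc m)
  then have "(\<lambda>x. f (x - a)) differentiable (at x)" for x
    by (intro differentiable_compose[of f "\<lambda>x. x - a"]) (auto intro!: derivative_intros)
  moreover have "Ck m (\<lambda>x. frechet_derivative f (at (x - a)) v)" for v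
    using Suc.prems by (intro Suc.IH[of "\<lambda>x. frechet_derivative f (at x) v"]) simp
  ultimately show ?case using Suc.prems by (simp add: frechet_derivative_translate)
qed

lemma smooth_translate: "smooth f \<Longrightarrow> smooth (\<lambda>x. f (x - a))"
  by (simp add: smooth_def Ck_translate)

section \<open>Compactly supported functions and the divergence theorem\<close>

text \<open>An explicit radius instead of a compact support: when a support grows by the radius of a
  mollifier or the length of a shift, the new radius is given by the triangle inequality.\<close>

definition vanishes_outside :: "real \<Rightarrow> ('a::real_normed_vector \<Rightarrow> 'b::zero) \<Rightarrow> bool" where
  "vanishes_outside R f \<longleftrightarrow> (\<forall>x. R < norm x \<longrightarrow> f x = 0)"

lemma vanishes_outsideD: "vanishes_outside R f \<Longrightarrow> R < norm x \<Longrightarrow> f x = 0"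
  by (simp add: vanishes_outside_def)

lemma test_functionI:
  assumes "smooth \<phi>" "vanishes_outside R \<phi>"
  shows "test_function \<phi>"
proof -
  have "{x. \<phi> x \<noteq> 0} \<subseteq> cball 0 R"
    using assms(2) by (force simp: vanishes_outside_def)
  then have "bounded {x. \<phi> x \<noteq> 0}" using bounded_cball bounded_subset by blast
  then show ?thesis using assms(1) by (simp add: test_function_def)
qed

lemma test_functionE:
  assumes "test_function \<phi>"
  obtains R where "R > 0" "smooth \<phi>" "vanishes_outside R \<phi>"
proof -
  have "bounded (closure {x. \<phi> x \<noteq> 0})"
    using assms compact_imp_bounded by (auto simp: test_function_def)
  then obtain R where R: "R > 0" "\<And>x. x \<in> closure {x. \<phi> x \<noteq> 0} \<Longrightarrow> norm x \<le> R"
    using bounded_pos by metis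
  then have "vanishes_outside R \<phi>"
    using closure_subset[of "{x. \<phi> x \<noteq> 0}"] by (force simp: vanishes_outside_def)
  with R that assms show ?thesis by (auto simp: test_function_def)
qed

lemma integrable_bounded_support:
  fixes k :: "'a::euclidean_space \<Rightarrow> real"
  assumes "k \<in> borel_measurable borel" "\<And>x. \<bar>k x\<bar> \<le> B" "vanishes_outside R k"
  shows "integrable lborel k"
proof (rule Bochner_Integration.integrable_bound)
  show "integrable lborel (\<lambda>x::'a. B * indicator (cball 0 R) x)"
    using emeasure_lborel_cball_finite by (intro integrable_mult_right integrable_real_indicator) auto
  show "AE x in lborel. norm (k x) \<le> norm (B * indicator (cball 0 R) x)"
    using assms(2,3) by (intro AE_I2)
      (auto simp: indicator_def vanishes_outside_def intro: order_trans[OF _ abs_ge_self])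
qed (use assms in auto)

text \<open>A non-integrable \<open>k\<close> has Bochner integral \<open>0\<close>, so the bound
  covers that case as well; inner integrals of functions of two variables can thus be estimated
  directly.\<close>

lemma integral_abs_le:
  fixes k g :: "'a \<Rightarrow> real"
  assumes "integrable M g" "\<And>x. \<bar>k x\<bar> \<le> g x"
  shows "\<bar>\<integral>x. k x \<partial>M\<bar> \<le> (\<integral>x. g x \<partial>M)"
proof -
  have "norm (\<integral>x. k x \<partial>M) \<le> (\<integral>x. norm (k x) \<partial>M)"
    by (rule integral_norm_bound)
  also have "\<dots> \<le> (\<integral>x. g x \<partial>M)"
    by (intro integral_mono_AE' assms(1) AE_I2) (use assms(2) order_trans[OF abs_ge_zero assms(2)] in auto)
  finally show ?thesis by simp
qed

lemma integral_bounded_support: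
  fixes k :: "'a::euclidean_space \<Rightarrow> real"
  assumes "\<And>x. \<bar>k x\<bar> \<le> B" "\<And>x. dist a x > r \<Longrightarrow> k x = 0"
  shows "\<bar>\<integral>x. k x \<partial>lborel\<bar> \<le> B * measure lborel (cball a r)"
proof -
  have i: "integrable lborel (\<lambda>x::'a. B * indicator (cball a r) x)"
    using emeasure_lborel_cball_finite by (intro integrable_mult_right integrable_real_indicator) auto
  have "\<bar>k x\<bar> \<le> B * indicator (cball a r) x" for x
    using assms(1)[of x] assms(2)[of x] by (auto simp: indicator_def not_le)
  from integral_abs_le[OF i this] show ?thesis by simp
qed

lemma bounded_on_cball:
  fixes u :: "'a::euclidean_space \<Rightarrow> 'b::real_normed_vector"
  assumes "continuous_on UNIV u"
  obtains B where "B > 0" "\<And>x. norm x \<le> R \<Longrightarrow> norm (u x) \<le> B"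
proof -
  have "bounded (u ` cball 0 R)"
    by (intro compact_imp_bounded compact_continuous_image continuous_on_subset[OF assms]) auto
  then obtain B where "B > 0" "\<forall>y\<in>u ` cball 0 R. norm y \<le> B"
    using bounded_pos by metis
  with that show ?thesis by auto
qed

lemma vanishes_outside_bounded:
  fixes u :: "'a::euclidean_space \<Rightarrow> 'b::real_normed_vector"
  assumes "continuous_on UNIV u" "vanishes_outside R u"
  obtains B where "B > 0" "\<And>x. norm (u x) \<le> B"
proof -
  obtain B where "B > 0" "\<And>x. norm x \<le> R \<Longrightarrow> norm (u x) \<le> B"
    using bounded_on_cball[OF assms(1)] by metis
  then have "norm (u x) \<le> B" for x
    using assms(2) by (cases "norm x \<le> R") (auto simp: vanishes_outside_def)
  with \<open>B > 0\<close> that show ?thesis by blast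
qed

lemma integrable_vanishes_outside:
  fixes u :: "'a::euclidean_space \<Rightarrow> real"
  assumes "continuous_on UNIV u" "vanishes_outside R u"
  shows "integrable lborel u"
proof -
  obtain B where "B > 0" "\<And>x. norm (u x) \<le> B"
    using vanishes_outside_bounded[OF assms] by metis
  then show ?thesis
    using assms by (intro integrable_bounded_support) (auto intro: borel_measurable_continuous_onI)
qed

lemma frechet_derivative_vanishes_outside:
  assumes "vanishes_outside R u"
  shows "vanishes_outside R (\<lambda>x. frechet_derivative u (at x) v)"
proof -
  have "frechet_derivative u (at x) v = 0" if "R < norm x" for x
  proof -
    have "open {x::'a. R < norm x}" by (intro open_Collect_less continuous_intros)
    then have "(u has_derivative (\<lambda>_. 0)) (at x)"
      by (rule has_derivative_transform_within_open[OF has_derivative_const])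
        (use assms that in \<open>auto simp: vanishes_outside_def\<close>)
    then show ?thesis by (simp add: frechet_derivative_eqI)
  qed
  then show ?thesis by (simp add: vanishes_outside_def)
qed

lemma Ck1_continuous:
  assumes "Ck (Suc 0) u"
  shows "continuous_on UNIV u" "continuous_on UNIV (\<lambda>x. frechet_derivative u (at x) v)"
  using assms Ck_Suc_imp[OF assms] by auto

section \<open>The divergence theorem for compactly supported functions\<close>

lemma lborel_integral_translate:
  fixes u :: "'a::euclidean_space \<Rightarrow> real"
  assumes "u \<in> borel_measurable borel"
  shows "(\<integral>x. u (x + a) \<partial>lborel) = (\<integral>x. u x \<partial>lborel)"
proof -
  have "(\<integral>x. u x \<partial>lborel) = (\<integral>x. u x \<partial>(distr lborel borel ((+) a)))"
    by (simp add: lborel_distr_plus)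
  also have "\<dots> = (\<integral>x. u (a + x) \<partial>lborel)"
    using assms by (subst integral_distr) auto
  finally show ?thesis by (simp add: add.commute)
qed

text \<open>Difference quotients have integral \<open>0\<close> by translation invariance of
  Lebesgue measure, and they converge to the derivative under a common integrable bound.\<close>

lemma integral_directional_derivative:
  assumes "Ck (Suc 0) u" "vanishes_outside R u"
  shows "(\<integral>x. frechet_derivative u (at x) v \<partial>lborel) = (0::real)"
proof -
  let ?D = "\<lambda>x. frechet_derivative u (at x) v"
  define h where "h n = inverse (real (Suc n))" for n
  have h: "h n > 0" "h n \<le> 1" for n by (auto simp: h_def field_simps)
  have h0: "filterlim h (at 0) sequentially"
    unfolding filterlim_at using LIMSEQ_inverse_real_of_nat h(1) by (auto simp: h_def[abs_def])
  have cont: "continuous_on UNIV u" "continuous_on UNIV ?D"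
    using Ck1_continuous[OF assms(1)] by auto
  have [measurable]: "u \<in> borel_measurable borel"
    using cont by (simp add: borel_measurable_continuous_onI)
  obtain B where B: "B > 0" "\<And>x. norm (?D x) \<le> B"
    using vanishes_outside_bounded[OF cont(2) frechet_derivative_vanishes_outside[OF assms(2)]] by metis
  have line: "((\<lambda>t. u (x + t *\<^sub>R v)) has_real_derivative ?D (x + t *\<^sub>R v)) (at t)" for x t
  proof -
    have "((\<lambda>t. x + t *\<^sub>R v) has_derivative (\<lambda>s. s *\<^sub>R v)) (at t)"
      by (auto intro!: derivative_eq_intros)
    moreover have d: "(u has_derivative frechet_derivative u (at (x + t *\<^sub>R v))) (at (x + t *\<^sub>R v))"
      using assms(1) frechet_derivative_works by auto
    ultimately have "((\<lambda>t. u (x + t *\<^sub>R v)) has_derivative (\<lambda>s. frechet_derivative u (at (x + t *\<^sub>R v)) (s *\<^sub>R v))) (at t)"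
      by (rule has_derivative_compose)
    then show ?thesis
      unfolding has_field_derivative_def
      using linear_scale[OF has_derivative_linear[OF d]] by (simp add: mult.commute[of _ "?D _"] mult_commute_abs)
  qed
  let ?s = "\<lambda>n x. (u (x + h n *\<^sub>R v) - u x) / h n"
  have "(\<lambda>n. \<integral>x. ?s n x \<partial>lborel) \<longlonglongrightarrow> (\<integral>x. ?D x \<partial>lborel)"
  proof (rule integral_dominated_convergence)
    show "?D \<in> borel_measurable lborel"
      using cont by (simp add: borel_measurable_continuous_onI)
    \<comment> \<open>Since \<open>h n \<le> 1\<close>, no shift is longer than
      \<open>norm v\<close>, so this ball contains the supports of all quotients; the mean value
      theorem along the line bounds each of them by \<open>B\<close>.\<close>
    show "integrable lborel (\<lambda>x::real^'a. B * indicator (cball 0 (R + norm v)) x)"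
      using emeasure_lborel_cball_finite by (intro integrable_mult_right integrable_real_indicator) auto
    show "AE x in lborel. (\<lambda>n. ?s n x) \<longlonglongrightarrow> ?D x"
    proof (rule AE_I2)
      fix x
      have "((\<lambda>t. (u (x + t *\<^sub>R v) - u x) / t) \<longlongrightarrow> ?D x) (at 0)"
        using line[of x 0] by (simp add: DERIV_def)
      then show "(\<lambda>n. ?s n x) \<longlonglongrightarrow> ?D x"
        using filterlim_compose h0 by blast
    qed
    show "AE x in lborel. norm (?s n x) \<le> B * indicator (cball 0 (R + norm v)) x" for n
    proof (rule AE_I2)
      fix x
      show "norm (?s n x) \<le> B * indicator (cball 0 (R + norm v)) x"
      proof (cases "norm x \<le> R + norm v")
        case True
        obtain t where "u (x + h n *\<^sub>R v) - u (x + 0 *\<^sub>R v) = (h n - 0) * ?D (x + t *\<^sub>R v)"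
          using MVT2[OF h(1)[of n], of "\<lambda>t. u (x + t *\<^sub>R v)" "\<lambda>t. ?D (x + t *\<^sub>R v)"] line by blast
        with True B h(1)[of n] show ?thesis by simp
      next
        case False
        have "norm (h n *\<^sub>R v) \<le> norm v"
          using h[of n] by (simp add: mult_left_le_one_le)
        moreover have "norm x \<le> norm (x + h n *\<^sub>R v) + norm (h n *\<^sub>R v)"
          by (metis add_diff_cancel_right' norm_triangle_ineq4)
        ultimately have "R < norm (x + h n *\<^sub>R v)" "R < norm x"
          using False norm_ge_zero[of v] by linarith+
        then show ?thesis using assms(2) False by (simp add: vanishes_outside_def)
      qed
    qed
  qed measurable
  moreover have "(\<integral>x. ?s n x \<partial>lborel) = 0" for n
  proof -
    have "integrable lborel u" using integrable_vanishes_outside cont assms(2) by blast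
    moreover have "integrable lborel (\<lambda>x. u (x + h n *\<^sub>R v))"
    proof (rule integrable_vanishes_outside)
      show "continuous_on UNIV (\<lambda>x. u (x + h n *\<^sub>R v))"
        by (intro continuous_on_compose2[OF cont(1)] continuous_intros) auto
      have "norm x - norm (h n *\<^sub>R v) \<le> norm (x + h n *\<^sub>R v)" for x
        by (metis add_diff_cancel_right' diff_le_eq norm_triangle_ineq4)
      then show "vanishes_outside (R + norm (h n *\<^sub>R v)) (\<lambda>x. u (x + h n *\<^sub>R v))"
        using assms(2) unfolding vanishes_outside_def by (smt (verit))
    qed
    ultimately show ?thesis
      using lborel_integral_translate[of u "h n *\<^sub>R v"] by simp
  qed
  ultimately have "(\<lambda>_. 0) \<longlonglongrightarrow> (\<integral>x. ?D x \<partial>lborel)"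
    by (simp only:)
  then show ?thesis by (simp add: LIMSEQ_const_iff)
qed

lemma has_derivative_vec_nth:
  fixes V :: "'a::real_normed_vector \<Rightarrow> real ^ 'n"
  assumes "V differentiable at x"
  shows "((\<lambda>x. V x $ j) has_derivative (\<lambda>v. frechet_derivative V (at x) v $ j)) (at x)"
  using assms by (intro bounded_linear.has_derivative[OF bounded_linear_vec_nth])
    (simp add: frechet_derivative_works[symmetric])

lemma Ck_vec_nth:
  fixes V :: "real ^ 'n \<Rightarrow> real ^ 'm"
  shows "Ck m V \<Longrightarrow> Ck m (\<lambda>x. V x $ j)"
proof (induction m arbitrary: V)
  case 0
  then show ?case by (auto intro!: continuous_intros)
next
  case (Suc m)
  then have d: "((\<lambda>x. V x $ j) has_derivative (\<lambda>v. frechet_derivative V (at x) v $ j)) (at x)" for x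
    by (auto intro: has_derivative_vec_nth)
  with Suc show ?case
    by (auto simp: differentiable_def frechet_derivative_eqI[OF d])
qed

lemma frechet_derivative_sum_axis:
  fixes \<phi> :: "real ^ 'n \<Rightarrow> real"
  assumes "\<phi> differentiable (at x)"
  shows "frechet_derivative \<phi> (at x) w = (\<Sum>j\<in>UNIV. w $ j * frechet_derivative \<phi> (at x) (axis j 1))"
proof -
  have l: "linear (frechet_derivative \<phi> (at x))"
    using assms linear_frechet_derivative by blast
  have "w = (\<Sum>j\<in>UNIV. w $ j *\<^sub>R axis j 1)"
    by (simp add: scalar_mult_eq_scaleR[symmetric] basis_expansion)
  then have "frechet_derivative \<phi> (at x) w =
      (\<Sum>j\<in>UNIV. frechet_derivative \<phi> (at x) (w $ j *\<^sub>R axis j 1))"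
    using linear_sum[OF l, of "\<lambda>j. w $ j *\<^sub>R axis j 1" UNIV] by simp
  also have "\<dots> = (\<Sum>j\<in>UNIV. w $ j * frechet_derivative \<phi> (at x) (axis j 1))"
    using linear_scale[OF l] by simp
  finally show ?thesis .
qed

text \<open>As \<open>V\<close> has divergence zero, \<open>V u\<close> is the divergence of the
  compactly supported field \<open>u V\<close>, whose components are the functions
  \<open>w j\<close>.\<close>

lemma integral_apply_field:
  assumes V: "Ck (Suc 0) V" "\<And>x. divergence V x = 0" and u: "Ck (Suc 0) u" "vanishes_outside R u"
  shows "(\<integral>x. apply_field V u x \<partial>lborel) = 0"
proof -
  define w where "w j x = V x $ j * u x" for j x
  let ?D = "\<lambda>j x. frechet_derivative (w j) (at x) (axis j 1)"
  have du: "u differentiable (at x)" and dV: "V differentiable (at x)" for x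
    using u V by auto
  have w: "Ck (Suc 0) (w j)" "vanishes_outside R (w j)" for j
    using u Ck_mult[OF Ck_vec_nth[OF V(1)] u(1)] by (auto simp: w_def[abs_def] vanishes_outside_def)
  have "?D j x = V x $ j * frechet_derivative u (at x) (axis j 1)
      + frechet_derivative V (at x) (axis j 1) $ j * u x" for j x
  proof -
    note d = has_derivative_vec_nth[OF dV, of j x]
    then have "(\<lambda>x. V x $ j) differentiable (at x)" by (auto simp: differentiable_def)
    then show ?thesis
      unfolding w_def[abs_def]
      by (simp only: frechet_derivative_mult[OF _ du] frechet_derivative_eqI[OF d])
  qed
  then have "(\<Sum>j\<in>UNIV. ?D j x) = apply_field V u x + divergence V x * u x" for x
    by (simp add: apply_field_def frechet_derivative_sum_axis[OF du, of _ "V _"] divergence_def sum.distrib sum_distrib_right)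
  then have "(\<integral>x. apply_field V u x \<partial>lborel) = (\<integral>x. (\<Sum>j\<in>UNIV. ?D j x) \<partial>lborel)"
    by (simp add: V(2))
  also have "\<dots> = (\<Sum>j\<in>UNIV. \<integral>x. ?D j x \<partial>lborel)"
    using w Ck1_continuous[OF w(1)]
    by (intro Bochner_Integration.integral_sum integrable_vanishes_outside)
      (auto intro: frechet_derivative_vanishes_outside)
  finally show ?thesis using integral_directional_derivative[OF w] by simp
qed

section \<open>Mollifiers\<close>

lemma smooth_const: "smooth (\<lambda>x::real ^ 'n. a)"
proof -
  have "Ck k (\<lambda>x::real ^ 'n. a)" for k by (induction k arbitrary: a) auto
  then show ?thesis by (simp add: smooth_def)
qed

lemma flat_0_bounds: "flat 0 t \<le> 1" "3/4 \<le> t \<Longrightarrow> exp (- 4/3) \<le> flat 0 t"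
proof -
  show "flat 0 t \<le> 1" by (simp add: flat_def)
  assume t: "3/4 \<le> t"
  then have "inverse t \<le> inverse (3/4)" by (intro le_imp_inverse_le) auto
  with t show "exp (- 4/3) \<le> flat 0 t" by (simp add: flat_def)
qed

text \<open>\<open>flat 2\<close> is the derivative of \<open>flat 0\<close>, so this controls the
  gradient of the bump. It is the inequality \<open>s^2 / 2 \<le> exp s\<close> at
  \<open>s = 1/t\<close>.\<close>

lemma flat_2_le: "flat 2 t \<le> 2"
proof (cases "t > 0")
  case True
  define s where "s = inverse t"
  have "s > 0" using True by (simp add: s_def)
  then have "s\<^sup>2 / 2 \<le> exp s" using exp_lower_Taylor_quadratic[of s] by simp
  then have "exp (- s) * s\<^sup>2 \<le> 2" by (simp add: exp_minus field_simps)
  then show ?thesis using True by (simp add: flat_def s_def)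
qed (simp add: flat_def)

text \<open>The bounds are stated relative to the volume of the ball of radius \<epsilon>, with one
  \<open>K\<close> for all \<epsilon>: integrating over such a ball then costs nothing, and only the
  factor \<open>1/\<epsilon>\<close> of the derivative remains. Evenness lets the same kernel be
  read as a test function in either variable.\<close>

lemma mollifiers:
  obtains K where "K > 0"
    "\<And>\<epsilon>. 0 < \<epsilon> \<Longrightarrow> \<exists>\<eta> :: real ^ 'n \<Rightarrow> real. smooth \<eta> \<and> vanishes_outside \<epsilon> \<eta> \<and>
      (\<forall>x. \<eta> (- x) = \<eta> x) \<and> (\<forall>x v. frechet_derivative \<eta> (at (- x)) v = - frechet_derivative \<eta> (at x) v) \<and>
      (\<integral>x. \<eta> x \<partial>lborel) = 1 \<and>
      (\<forall>x. \<bar>\<eta> x\<bar> * measure lborel (cball (0::real ^ 'n) \<epsilon>) \<le> K) \<and>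
      (\<forall>x v. \<bar>frechet_derivative \<eta> (at x) v\<bar> * measure lborel (cball (0::real ^ 'n) \<epsilon>) \<le> K * norm v / \<epsilon>)"
proof -
  let ?W = "\<lambda>\<epsilon>. measure lborel (cball (0::real ^ 'n) \<epsilon>)"
  \<comment> \<open>On the ball of radius \<open>\<epsilon>/2\<close> the bump is at least
    \<open>exp (- 4/3)\<close>, which bounds its integral below; \<open>2 ^ CARD('n)\<close>
    compares the volumes of the two balls. The factor \<open>4\<close> is the bound \<open>2\<close>
    of \<open>flat 2\<close> times the \<open>2\<close> from differentiating
    \<open>x \<bullet> x\<close>.\<close>
  define K :: real where "K = 4 * 2 ^ CARD('n) * exp (4/3)"
  have K: "K > 0" by (simp add: K_def)
  show thesis
  proof (rule that[OF K])
    fix \<epsilon> :: real assume e: "\<epsilon> > 0"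
    define c where "c = inverse (\<epsilon>\<^sup>2)"
    have c: "c > 0" using e by (simp add: c_def)
    define b where "b = (\<lambda>x::real ^ 'n. flat 0 (1 - c * (x \<bullet> x)))"
    define m where "m = (\<integral>x. b x \<partial>lborel)"
    define \<eta> where "\<eta> = (\<lambda>x. inverse m * b x)"
    have b: "smooth b" "\<And>x. 0 \<le> b x" "\<And>x. b x \<le> 1"
      by (auto simp: b_def smooth_flat_inner flat_nonneg flat_0_bounds)
    have t: "1 - c * (x \<bullet> x) \<le> 0" if "\<epsilon> < norm x" for x :: "real ^ 'n"
    proof -
      have "\<epsilon>\<^sup>2 \<le> x \<bullet> x"
        using that e by (simp add: power2_norm_eq_inner[symmetric] power_mono)
      then show ?thesis using e by (simp add: c_def field_simps)
    qed
    then have bv: "vanishes_outside \<epsilon> b"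
      by (auto simp: vanishes_outside_def b_def flat_def)
    have bc: "continuous_on UNIV b" using b(1) Ck.simps(1) unfolding smooth_def by blast
    have bi: "integrable lborel b" by (rule integrable_vanishes_outside[OF bc bv])
    have W: "?W \<epsilon> > 0" using e content_cball_gt_0_iff[of "0::real ^ 'n" \<epsilon>] by simp
    have "exp (- 4/3) * ?W (\<epsilon>/2) = (\<integral>x. exp (- 4/3) * indicator (cball (0::real ^ 'n) (\<epsilon>/2)) x \<partial>lborel)"
      by simp
    also have "\<dots> \<le> m"
      unfolding m_def
    proof (rule integral_mono)
      show "integrable lborel (\<lambda>x. exp (- 4/3) * indicator (cball (0::real ^ 'n) (\<epsilon>/2)) x :: real)"
        using emeasure_lborel_cball_finite by (intro integrable_mult_right integrable_real_indicator) auto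
      show "exp (- 4/3) * indicator (cball 0 (\<epsilon>/2)) x \<le> b x" for x
      proof (cases "norm x \<le> \<epsilon>/2")
        case True
        then have "x \<bullet> x \<le> (\<epsilon>/2)\<^sup>2"
          by (metis norm_ge_zero power2_norm_eq_inner power_mono)
        then have "3/4 \<le> 1 - c * (x \<bullet> x)"
          using e by (simp add: c_def field_simps power2_eq_square)
        then show ?thesis using True flat_0_bounds(2) by (simp add: b_def)
      qed (simp add: b)
    qed (rule bi)
    finally have "exp (- 4/3) * ?W (\<epsilon>/2) \<le> m" .
    moreover have "?W \<epsilon> = 2 ^ CARD('n) * ?W (\<epsilon>/2)"
      using content_cball[of \<epsilon> "0::real ^ 'n"] content_cball[of "\<epsilon>/2" "0::real ^ 'n"] e
      by (simp add: power_divide)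
    ultimately have mW: "4 * ?W \<epsilon> \<le> K * m"
      by (simp add: K_def exp_minus field_simps)
    then have m: "m > 0" using W K by (smt (verit) zero_less_mult_pos)
    have mW': "inverse m * ?W \<epsilon> * 4 \<le> K" using mW m by (simp add: field_simps)
    define D where "D x v = flat 2 (1 - c * (x \<bullet> x)) * (- 2 * c * (x \<bullet> v))" for x v :: "real ^ 'n"
    have "(b has_derivative D x) (at x)" for x
      using flat_inner_has_derivative[of 0 c x] by (simp add: b_def D_def[abs_def] numeral_2_eq_2)
    then have "(\<eta> has_derivative (\<lambda>v. inverse m * D x v)) (at x)" for x
      unfolding \<eta>_def by (rule has_derivative_mult_right)
    then have d: "frechet_derivative \<eta> (at x) = (\<lambda>v. inverse m * D x v)" for x
      by (rule frechet_derivative_eqI)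
    have Db: "\<bar>D x v\<bar> \<le> 4 * norm v / \<epsilon>" for x v
    proof (cases "norm x \<le> \<epsilon>")
      case True
      have "\<bar>x \<bullet> v\<bar> \<le> \<epsilon> * norm v"
        by (rule order_trans[OF Cauchy_Schwarz_ineq2 mult_right_mono[OF True norm_ge_zero]])
      then have "\<bar>2 * c * (x \<bullet> v)\<bar> \<le> 2 * c * (\<epsilon> * norm v)"
        using c by (simp add: abs_mult)
      then have "flat 2 (1 - c * (x \<bullet> x)) * \<bar>2 * c * (x \<bullet> v)\<bar> \<le> 2 * (2 * c * (\<epsilon> * norm v))"
        by (intro mult_mono flat_2_le) auto
      also have "\<dots> = 4 * norm v / \<epsilon>"
        using e by (simp add: c_def field_simps power2_eq_square)
      finally show ?thesis by (simp add: D_def abs_mult flat_nonneg)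
    next
      case False
      then have "D x v = 0" using t[of x] by (simp add: D_def flat_def)
      then show ?thesis using e by simp
    qed
    have "smooth \<eta>"
      unfolding \<eta>_def by (rule smooth_mult[OF smooth_const b(1)])
    moreover have "vanishes_outside \<epsilon> \<eta>"
      using bv by (auto simp: vanishes_outside_def \<eta>_def)
    moreover have "(\<integral>x. \<eta> x \<partial>lborel) = 1"
      using m by (simp add: \<eta>_def m_def)
    moreover have "\<bar>\<eta> x\<bar> * ?W \<epsilon> \<le> K" for x
    proof -
      have "\<bar>\<eta> x\<bar> * ?W \<epsilon> = b x * (inverse m * ?W \<epsilon>)"
        using b(2)[of x] m by (simp add: \<eta>_def abs_mult)
      also have "\<dots> \<le> 1 * (inverse m * ?W \<epsilon>)"
        using b(3) m W by (intro mult_right_mono) auto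
      also have "\<dots> \<le> inverse m * ?W \<epsilon> * 4" using m W by simp
      finally show ?thesis using mW' by simp
    qed
    moreover have "\<bar>frechet_derivative \<eta> (at x) v\<bar> * ?W \<epsilon> \<le> K * norm v / \<epsilon>" for x v
    proof -
      have "\<bar>frechet_derivative \<eta> (at x) v\<bar> * ?W \<epsilon> = \<bar>D x v\<bar> * (inverse m * ?W \<epsilon>)"
        using m by (simp add: d abs_mult)
      also have "\<dots> \<le> (4 * norm v / \<epsilon>) * (inverse m * ?W \<epsilon>)"
        using Db m W by (intro mult_right_mono) auto
      also have "\<dots> = (inverse m * ?W \<epsilon> * 4) * (norm v / \<epsilon>)" by simp
      also have "\<dots> \<le> K * (norm v / \<epsilon>)"
        using mW' e by (intro mult_right_mono) auto
      finally show ?thesis by simp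
    qed
    moreover have "\<eta> (- x) = \<eta> x" for x by (simp add: \<eta>_def b_def)
    moreover have "frechet_derivative \<eta> (at (- x)) v = - frechet_derivative \<eta> (at x) v" for x v
      by (simp add: d D_def)
    ultimately show "\<exists>\<eta> :: real ^ 'n \<Rightarrow> real. smooth \<eta> \<and> vanishes_outside \<epsilon> \<eta> \<and>
      (\<forall>x. \<eta> (- x) = \<eta> x) \<and> (\<forall>x v. frechet_derivative \<eta> (at (- x)) v = - frechet_derivative \<eta> (at x) v) \<and>
      (\<integral>x. \<eta> x \<partial>lborel) = 1 \<and>
      (\<forall>x. \<bar>\<eta> x\<bar> * ?W \<epsilon> \<le> K) \<and>
      (\<forall>x v. \<bar>frechet_derivative \<eta> (at x) v\<bar> * ?W \<epsilon> \<le> K * norm v / \<epsilon>)"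
      by (intro exI[of _ \<eta>] conjI allI)
  qed
qed

section \<open>The product rule\<close>

definition bounded_borel :: "('a::euclidean_space \<Rightarrow> real) \<Rightarrow> bool" where
  "bounded_borel k \<longleftrightarrow> k \<in> borel_measurable borel \<and> (\<exists>B. \<forall>x. \<bar>k x\<bar> \<le> B)"

lemma bounded_borel_measurable: "bounded_borel k \<Longrightarrow> k \<in> borel_measurable borel"
  by (simp add: bounded_borel_def)

lemma bounded_borel_mult:
  assumes "bounded_borel k" "bounded_borel l"
  shows "bounded_borel (\<lambda>x. k x * l x)"
proof -
  obtain A B where "\<forall>x. \<bar>k x\<bar> \<le> A" "\<forall>x. \<bar>l x\<bar> \<le> B"
    using assms by (auto simp: bounded_borel_def)
  then have "\<bar>k x * l x\<bar> \<le> A * B" for x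
    unfolding abs_mult by (intro mult_mono) (auto intro: order_trans[OF abs_ge_zero])
  with assms show ?thesis by (auto simp: bounded_borel_def)
qed

lemma bounded_borel_add:
  assumes "bounded_borel k" "bounded_borel l"
  shows "bounded_borel (\<lambda>x. k x + l x)"
proof -
  obtain A B where "\<forall>x. \<bar>k x\<bar> \<le> A" "\<forall>x. \<bar>l x\<bar> \<le> B"
    using assms by (auto simp: bounded_borel_def)
  then have "\<bar>k x + l x\<bar> \<le> A + B" for x
    by (meson abs_triangle_ineq add_mono order_trans)
  with assms show ?thesis by (auto simp: bounded_borel_def)
qed

lemma bounded_borel_const: "bounded_borel (\<lambda>_. c)"
  by (auto simp: bounded_borel_def)

lemma bounded_borel_sum: "finite I \<Longrightarrow> (\<And>i. i \<in> I \<Longrightarrow> bounded_borel (k i)) \<Longrightarrow> bounded_borel (\<lambda>x. \<Sum>i\<in>I. k i x)"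
  by (induction I rule: finite_induct) (auto simp: bounded_borel_const intro: bounded_borel_add)

lemma bounded_borel_compose:
  "bounded_borel k \<Longrightarrow> h \<in> borel_measurable borel \<Longrightarrow> bounded_borel (\<lambda>x. k (h x))"
  by (auto simp: bounded_borel_def)

lemma bounded_borel_pair:
  fixes k :: "'a::euclidean_space \<Rightarrow> real" and l :: "'b::euclidean_space \<Rightarrow> real"
  shows "bounded_borel k \<Longrightarrow> bounded_borel (\<lambda>z::'a \<times> 'b. k (fst z))"
    "bounded_borel l \<Longrightarrow> bounded_borel (\<lambda>z::'a \<times> 'b. l (snd z))"
    "bounded_borel k \<Longrightarrow> bounded_borel (\<lambda>z::'a \<times> 'a. k (fst z - snd z))"
  using bounded_borel_compose[of k "fst :: 'a \<times> 'b \<Rightarrow> 'a"] bounded_borel_compose[of l "snd :: 'a \<times> 'b \<Rightarrow> 'b"]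
    bounded_borel_compose[of k "\<lambda>z::'a \<times> 'a. fst z - snd z"]
  by (simp_all add: borel_measurable_continuous_onI continuous_intros)

lemma bounded_borel_continuous:
  assumes "continuous_on UNIV k" "vanishes_outside R k"
  shows "bounded_borel k"
proof -
  obtain B where "B > 0" "\<And>x. norm (k x) \<le> B"
    using vanishes_outside_bounded[OF assms] by metis
  then show ?thesis
    using borel_measurable_continuous_onI[OF assms(1)] by (auto simp: bounded_borel_def)
qed

text \<open>Continuous functions may be unbounded on the whole space. Truncated to a large ball they
  become admissible factors of integrands on the product space, and nothing changes inside that
  ball.\<close>

lemma bounded_borel_truncate:
  assumes "continuous_on UNIV k"
  shows "bounded_borel (\<lambda>x. indicator (cball 0 R) x * k x)"
proof -
  obtain B where "B > 0" "\<And>x. norm x \<le> R \<Longrightarrow> norm (k x) \<le> B"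
    using bounded_on_cball[OF assms] by metis
  then have "\<bar>indicator (cball 0 R) x * k x\<bar> \<le> B" for x
    by (cases "norm x \<le> R") (auto simp: indicator_def)
  moreover have [measurable]: "k \<in> borel_measurable borel"
    using assms by (rule borel_measurable_continuous_onI)
  moreover have "(\<lambda>x. indicator (cball 0 R) x * k x) \<in> borel_measurable borel"
    by (intro borel_measurable_times borel_measurable_indicator) auto
  ultimately show ?thesis by (auto simp: bounded_borel_def)
qed

lemma integrable_bounded_borel:
  assumes "bounded_borel k" "vanishes_outside R k"
  shows "integrable lborel k"
  using assms integrable_bounded_support by (auto simp: bounded_borel_def)

lemma iterated_integrals:
  fixes k :: "'a::euclidean_space \<times> 'b::euclidean_space \<Rightarrow> real"
  assumes "integrable lborel k"
  shows "(\<integral>x. \<integral>y. k (x, y) \<partial>lborel \<partial>lborel) = (\<integral>z. k z \<partial>lborel)"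
    and "(\<integral>y. \<integral>x. k (x, y) \<partial>lborel \<partial>lborel) = (\<integral>z. k z \<partial>lborel)"
proof -
  have "integrable (lborel \<Otimes>\<^sub>M lborel) (case_prod (\<lambda>x y. k (x, y)))"
    using assms by (simp add: lborel_prod)
  from lborel_pair.integral_fst[OF this] lborel_pair.integral_snd[OF this]
  show "(\<integral>x. \<integral>y. k (x, y) \<partial>lborel \<partial>lborel) = (\<integral>z. k z \<partial>lborel)"
    and "(\<integral>y. \<integral>x. k (x, y) \<partial>lborel \<partial>lborel) = (\<integral>z. k z \<partial>lborel)"
    by (simp_all add: lborel_prod)
qed

text \<open>For fixed \<open>x\<close> the integrand lives on the ball of radius \<epsilon> about
  \<open>x\<close>, whose volume cancels the volume factor in the assumed bound. What is left is
  \<open>c\<close>, integrated over the ball of radius \<open>R\<close>, so the estimate does not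
  degenerate as \<epsilon> tends to \<open>0\<close>.\<close>

lemma integral_near_diagonal_le:
  fixes k :: "'a::euclidean_space \<times> 'a \<Rightarrow> real"
  assumes k: "integrable lborel k"
    and b: "\<And>x y. norm x \<le> R \<Longrightarrow> norm (x - y) \<le> \<epsilon> \<Longrightarrow> \<bar>k (x, y)\<bar> * measure lborel (cball (0::'a) \<epsilon>) \<le> c"
    and z: "\<And>x y. R < norm x \<or> \<epsilon> < norm (x - y) \<Longrightarrow> k (x, y) = 0"
    and e: "\<epsilon> > 0"
  shows "\<bar>\<integral>z. k z \<partial>lborel\<bar> \<le> c * measure lborel (cball (0::'a) R)"
proof (cases "0 \<le> R")
  case True
  let ?W = "measure lborel (cball (0::'a) \<epsilon>)"
  have W: "?W > 0" using e content_cball_gt_0_iff[of "0::'a" \<epsilon>] by simp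
  have "0 \<le> \<bar>k (0, 0)\<bar> * ?W" using W by simp
  also have "\<dots> \<le> c" using b[of 0 0] True e by simp
  finally have c: "0 \<le> c" .
  have kb: "\<bar>k (x, y)\<bar> \<le> c / ?W" for x y
    using b[of x y] z[of x y] W c by (cases "norm x \<le> R \<and> norm (x - y) \<le> \<epsilon>") (auto simp: field_simps)
  have "\<bar>\<integral>y. k (x, y) \<partial>lborel\<bar> \<le> c" for x
  proof -
    have "\<bar>\<integral>y. k (x, y) \<partial>lborel\<bar> \<le> c / ?W * measure lborel (cball x \<epsilon>)"
      using kb z by (intro integral_bounded_support) (auto simp: dist_norm)
    also have "measure lborel (cball x \<epsilon>) = ?W"
      using content_cball[of \<epsilon> x] content_cball[of \<epsilon> "0::'a"] e by simp
    also have "c / ?W * ?W = c" using W by simp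
    finally show ?thesis .
  qed
  then have "\<bar>\<integral>x. \<integral>y. k (x, y) \<partial>lborel \<partial>lborel\<bar> \<le> c * measure lborel (cball (0::'a) R)"
    by (intro integral_bounded_support) (simp_all add: z)
  then show ?thesis by (simp add: iterated_integrals(1)[OF k])
next
  case False
  then have "k (x, y) = 0" for x y
    using z[of x y] norm_ge_zero[of x] by linarith
  then have "k = (\<lambda>_. 0)" by auto
  moreover have "cball (0::'a) R = {}" using False by simp
  ultimately show ?thesis by simp
qed

lemma vanishes_outside_apply_field:
  assumes "vanishes_outside R u"
  shows "vanishes_outside R (apply_field V u)"
  using frechet_derivative_vanishes_outside[OF assms] by (simp add: vanishes_outside_def apply_field_def)

lemma apply_field_continuous:
  assumes "Ck 0 V" "Ck (Suc 0) u"
  shows "continuous_on UNIV (apply_field V u)"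
proof -
  have "u differentiable (at x)" for x using assms(2) by simp
  from frechet_derivative_sum_axis[OF this] have "apply_field V u = (\<lambda>x. \<Sum>j\<in>UNIV. V x $ j * frechet_derivative u (at x) (axis j 1))"
    unfolding apply_field_def by blast
  then show ?thesis
    using Ck1_continuous(2)[OF assms(2)] assms(1) by (auto intro!: continuous_intros)
qed

text \<open>Doubling of variables: \<open>g\<close> is tested in \<open>x\<close> against \<open>\<phi> x * \<eta> (x - y)\<close> and \<open>f\<close> is tested in
  \<open>y\<close> against \<open>\<eta> (x - y)\<close>. On the right-hand side every term carries an increment that is
  small near the diagonal.\<close>

lemma product_rule_defect:
  fixes V :: "real ^ 'n \<Rightarrow> real ^ 'n" and f g f' g' \<phi> \<eta> :: "real ^ 'n \<Rightarrow> real"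
  assumes V: "smooth V" "\<And>x. divergence V x = 0"
    and fg: "continuous_on UNIV f" "continuous_on UNIV g" "bounded_borel f'" "bounded_borel g'"
    and \<phi>: "smooth \<phi>" "vanishes_outside R \<phi>"
    and \<eta>: "smooth \<eta>" "vanishes_outside \<epsilon> \<eta>" "\<And>x. \<eta> (- x) = \<eta> x" "(\<integral>x. \<eta> x \<partial>lborel) = 1"
      "\<And>x v. frechet_derivative \<eta> (at (- x)) v = - frechet_derivative \<eta> (at x) v"
    and \<epsilon>: "0 < \<epsilon>" "\<epsilon> \<le> 1"
    and Hf: "\<And>\<psi>. smooth \<psi> \<Longrightarrow> vanishes_outside (R + 1) \<psi> \<Longrightarrow>
        (\<integral>x. f' x * \<psi> x \<partial>lborel) = - (\<integral>x. f x * apply_field V \<psi> x \<partial>lborel)"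
    and Hg: "\<And>\<psi>. smooth \<psi> \<Longrightarrow> vanishes_outside (R + 1) \<psi> \<Longrightarrow>
        (\<integral>x. g' x * \<psi> x \<partial>lborel) = - (\<integral>x. g x * apply_field V \<psi> x \<partial>lborel)"
  defines "k \<equiv> \<lambda>(x, y). (f x - f y) * g' x * \<phi> x * \<eta> (x - y)
      + f' y * (g y * \<phi> y - g x * \<phi> x) * \<eta> (x - y)
      + (f x - f y) * g x * apply_field V \<phi> x * \<eta> (x - y)
      + (f x - f y) * g x * \<phi> x * frechet_derivative \<eta> (at (x - y)) (V x - V y)"
  shows "integrable lborel k"
    and "(\<integral>x. (f' x * g x + f x * g' x) * \<phi> x \<partial>lborel) + (\<integral>x. f x * g x * apply_field V \<phi> x \<partial>lborel)
      = (\<integral>z. k z \<partial>lborel)"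
proof -
  \<comment> \<open>Multiplied by \<open>cut\<close>, the functions \<open>f\<close>,
    \<open>g\<close> and the components of \<open>V\<close> are bounded Borel. The radius
    \<open>R + 1\<close> leaves room for one mollifier radius beyond the support of \<phi>.\<close>
  define cut :: "real ^ 'n \<Rightarrow> real" where "cut = indicator (cball 0 (R + 1))"
  have cut1: "cut x = 1" if "norm x \<le> R + 1" for x using that by (simp add: cut_def)
  define F where "F = (\<lambda>x. cut x * f x)"
  define G where "G = (\<lambda>x. cut x * g x)"
  define d\<eta> where "d\<eta> j x = frechet_derivative \<eta> (at x) (axis j 1)" for j x
  define d\<phi> where "d\<phi> j x = frechet_derivative \<phi> (at x) (axis j 1)" for j x
  define U where "U j = (\<lambda>x. cut x * V x $ j)" for j
  have C: "Ck m \<eta>" "Ck m \<phi>" "Ck m V" for m using \<eta> \<phi> V by (auto simp: smooth_def)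
  note diff = C[of "Suc 0"]
  have dif: "\<eta> differentiable (at x)" "\<phi> differentiable (at x)" for x using diff by auto
  have cV: "continuous_on UNIV (\<lambda>x. V x $ j)" for j
    using Ck_vec_nth[OF C(3)[of 0]] by simp
  have D\<eta>: "frechet_derivative \<eta> (at x) w = (\<Sum>j\<in>UNIV. w $ j * d\<eta> j x)" for x w
    unfolding d\<eta>_def by (rule frechet_derivative_sum_axis[OF dif(1)])
  have A\<phi>: "apply_field V \<phi> x = (\<Sum>j\<in>UNIV. V x $ j * d\<phi> j x)" for x
    unfolding d\<phi>_def apply_field_def by (rule frechet_derivative_sum_axis[OF dif(2)])
  have v: "vanishes_outside \<epsilon> (d\<eta> j)" "vanishes_outside R (d\<phi> j)" for j
    using frechet_derivative_vanishes_outside \<eta>(2) \<phi>(2) unfolding d\<eta>_def[abs_def] d\<phi>_def[abs_def] by blast+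
  have v0: "norm x \<le> R" if "\<phi> x \<noteq> 0 \<or> d\<phi> j x \<noteq> 0" for x j
    using that v(2)[of j] \<phi>(2) not_le unfolding vanishes_outside_def by metis
  have v1: "norm (x - y) \<le> 1" if "\<eta> (x - y) \<noteq> 0 \<or> d\<eta> j (x - y) \<noteq> 0" for x y j
    using that v(1)[of j] \<eta>(2) not_le \<epsilon>(2) order_trans unfolding vanishes_outside_def by metis
  have tri: "norm y \<le> norm x + norm (x - y)" "norm x \<le> norm y + norm (x - y)" for x y :: "real ^ 'n"
    by norm+
  have bb: "bounded_borel F" "bounded_borel G" "bounded_borel (U j)" "bounded_borel \<eta>" "bounded_borel \<phi>"
      "bounded_borel (d\<eta> j)" "bounded_borel (d\<phi> j)" for j
    using bounded_borel_truncate[OF fg(1)] bounded_borel_truncate[OF fg(2)] bounded_borel_truncate[OF cV]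
      bounded_borel_continuous \<eta>(2) \<phi>(2) v Ck1_continuous diff
    unfolding F_def G_def U_def cut_def d\<eta>_def[abs_def] d\<phi>_def[abs_def] by blast+
  note bp = bounded_borel_pair[OF bb(1)] bounded_borel_pair[OF bb(2)] bounded_borel_pair[OF bb(3)]
    bounded_borel_pair[OF bb(4)] bounded_borel_pair[OF bb(5)] bounded_borel_pair[OF bb(6)]
    bounded_borel_pair[OF bb(7)] bounded_borel_pair[OF fg(3)] bounded_borel_pair[OF fg(4)]
  note bi = bounded_borel_mult bounded_borel_sum bounded_borel_add bp
  define S where "S = 2 * \<bar>R\<bar> + 4"
  have van: "vanishes_outside S h"
    if "\<And>x y. h (x, y) \<noteq> 0 \<Longrightarrow> norm x \<le> R + 1 \<and> norm y \<le> R + 1" for h :: "(real ^ 'n) \<times> (real ^ 'n) \<Rightarrow> real"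
  proof -
    have "norm (x, y) \<le> S" if "norm x \<le> R + 1 \<and> norm y \<le> R + 1" for x y :: "real ^ 'n"
      using norm_Pair_le[of x y] that unfolding S_def by linarith
    with that show ?thesis unfolding vanishes_outside_def by (metis not_le surj_pair)
  qed
  text \<open>Each letter is one group of terms of \<open>k\<close>; the indices \<open>1\<close> and \<open>2\<close> mark the minuend and the
    subtrahend of its increment.\<close>
  define a1 where "a1 = (\<lambda>z. F (fst z) * g' (fst z) * \<phi> (fst z) * \<eta> (fst z - snd z))"
  define a2 where "a2 = (\<lambda>z. F (snd z) * g' (fst z) * \<phi> (fst z) * \<eta> (fst z - snd z))"
  define b1 where "b1 = (\<lambda>z. f' (snd z) * G (snd z) * \<phi> (snd z) * \<eta> (fst z - snd z))"
  define b2 where "b2 = (\<lambda>z. f' (snd z) * G (fst z) * \<phi> (fst z) * \<eta> (fst z - snd z))"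
  define c1 where "c1 = (\<lambda>z. F (fst z) * G (fst z) * (\<Sum>j\<in>UNIV. U j (fst z) * d\<phi> j (fst z)) * \<eta> (fst z - snd z))"
  define c2 where "c2 = (\<lambda>z. F (snd z) * G (fst z) * (\<Sum>j\<in>UNIV. U j (fst z) * d\<phi> j (fst z)) * \<eta> (fst z - snd z))"
  define d1 where "d1 = (\<lambda>z. F (fst z) * G (fst z) * \<phi> (fst z) * (\<Sum>j\<in>UNIV. U j (fst z) * d\<eta> j (fst z - snd z)))"
  define d2 where "d2 = (\<lambda>z. F (snd z) * G (fst z) * \<phi> (fst z) * (\<Sum>j\<in>UNIV. U j (fst z) * d\<eta> j (fst z - snd z)))"
  define e1 where "e1 = (\<lambda>z. F (fst z) * G (fst z) * \<phi> (fst z) * (\<Sum>j\<in>UNIV. U j (snd z) * d\<eta> j (fst z - snd z)))"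
  define e2 where "e2 = (\<lambda>z. F (snd z) * G (fst z) * \<phi> (fst z) * (\<Sum>j\<in>UNIV. U j (snd z) * d\<eta> j (fst z - snd z)))"
  note kdefs = a1_def a2_def b1_def b2_def c1_def c2_def d1_def d2_def e1_def e2_def
  have int: "integrable lborel a1" "integrable lborel a2" "integrable lborel b1" "integrable lborel b2"
    "integrable lborel c1" "integrable lborel c2" "integrable lborel d1" "integrable lborel d2"
    "integrable lborel e1" "integrable lborel e2"
  proof -
    have near: "norm x \<le> R + 1 \<and> norm y \<le> R + 1"
      if "(norm x \<le> R \<or> norm y \<le> R) \<and> norm (x - y) \<le> 1" for x y :: "real ^ 'n"
      using that tri[of x y] tri[of y x] by linarith
    have sumD: "\<exists>j. d\<eta> j x \<noteq> 0" if "(\<Sum>j\<in>UNIV. u j * d\<eta> j x) \<noteq> 0" for u x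
      using that by (metis (mono_tags, lifting) mult_zero_right sum.neutral)
    have sumE: "\<exists>j. d\<phi> j x \<noteq> 0" if "(\<Sum>j\<in>UNIV. u j * d\<phi> j x) \<noteq> 0" for u x
      using that by (metis (mono_tags, lifting) mult_zero_right sum.neutral)
    have *: "integrable lborel h"
      if "bounded_borel h" "\<And>x y. h (x, y) \<noteq> 0 \<Longrightarrow> (norm x \<le> R \<or> norm y \<le> R) \<and> norm (x - y) \<le> 1"
      for h :: "(real ^ 'n) \<times> (real ^ 'n) \<Rightarrow> real"
      using integrable_bounded_borel[OF that(1) van] that(2) near by blast
    show "integrable lborel a1" "integrable lborel a2" "integrable lborel b1" "integrable lborel b2"
      "integrable lborel c1" "integrable lborel c2" "integrable lborel d1" "integrable lborel d2"
      "integrable lborel e1" "integrable lborel e2"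
      unfolding kdefs
      by (rule *, (intro bi finite), use v0 v1 in \<open>(auto dest!: sumD sumE)[1]; blast\<close>)+
  qed
  \<comment> \<open>The truncation is invisible: far from the diagonal the kernel and its derivative
    vanish, outside radius \<open>R\<close> in both variables \<phi> and its derivatives vanish, and
    in the remaining case \<open>cut\<close> is \<open>1\<close> at both points.\<close>
  have keq: "k z = (a1 z - a2 z) + (b1 z - b2 z) + (c1 z - c2 z) + (d1 z - d2 z) - (e1 z - e2 z)" for z
  proof -
    obtain x y where z: "z = (x, y)" by (cases z)
    consider "1 < norm (x - y)" | "R < norm x" "R < norm y"
      | "norm x \<le> R + 1" "norm y \<le> R + 1"
      using tri[of x y] tri[of y x] by linarith
    then show ?thesis
    proof cases
      case 1
      then have "\<eta> (x - y) = 0" "d\<eta> j (x - y) = 0" for j using v1[of x y] by force+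
      then show ?thesis by (simp add: k_def kdefs z D\<eta>)
    next
      case 2
      then have "\<phi> x = 0" "\<phi> y = 0" "d\<phi> j x = 0" for j using v0[of x] v0[of y] by force+
      then show ?thesis by (simp add: k_def kdefs z A\<phi>)
    next
      case 3
      then have "cut x = 1" "cut y = 1" by (auto simp: cut1)
      then show ?thesis
        by (simp add: k_def kdefs z D\<eta> A\<phi> F_def G_def U_def algebra_simps sum_subtractf)
    qed
  qed
  then have keq': "k = (\<lambda>z. (a1 z - a2 z) + (b1 z - b2 z) + (c1 z - c2 z) + (d1 z - d2 z) - (e1 z - e2 z))"
    by blast
  show "integrable lborel k"
    unfolding keq' using int by simp
  have x1: "(\<integral>y. \<eta> (x - y) \<partial>lborel) = 1" for x
  proof -
    have "(\<integral>y. \<eta> (x - y) \<partial>lborel) = (\<integral>y. \<eta> (y + (- x)) \<partial>lborel)"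
      using \<eta>(3)[of "x - _"] by (intro Bochner_Integration.integral_cong) (auto simp: \<eta>(3)[symmetric, of "x - _"])
    then show ?thesis
      using lborel_integral_translate[of \<eta> "- x"] bounded_borel_measurable[OF bb(4)] \<eta>(4) by simp
  qed
  have y1: "(\<integral>x. \<eta> (x - y) \<partial>lborel) = 1" for y
    using lborel_integral_translate[of \<eta> "- y"] bounded_borel_measurable[OF bb(4)] \<eta>(4) by simp
  have \<phi>0: "norm x \<le> R" if "\<phi> x \<noteq> 0" for x using v0 that by blast
  have cut\<phi>: "cut x = 1" if "\<phi> x \<noteq> 0" for x using \<phi>0[OF that] by (intro cut1) simp
  \<comment> \<open>The kernel as a test function centred at \<open>x\<close>. By evenness it equals
    \<open>\<eta> (x - y)\<close>; its derivative is odd, which puts a minus sign in front of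
    \<open>V\<close> applied to it.\<close>
  define \<psi> :: "real ^ 'n \<Rightarrow> real ^ 'n \<Rightarrow> real" where "\<psi> x = (\<lambda>y. \<eta> (y - x))" for x
  have \<psi>: "smooth (\<psi> x)" for x unfolding \<psi>_def by (rule smooth_translate[OF \<eta>(1)])
  have \<psi>v: "vanishes_outside (R + 1) (\<psi> x)" if "norm x \<le> R" for x
    unfolding vanishes_outside_def
  proof (intro allI impI)
    fix y :: "real ^ 'n" assume "R + 1 < norm y"
    then have "\<not> norm (y - x) \<le> 1" using that tri(2)[of y x] by linarith
    then show "\<psi> x y = 0" using v1[of y x] by (auto simp: \<psi>_def)
  qed
  have \<psi>d: "frechet_derivative (\<psi> x) (at y) w = frechet_derivative \<eta> (at (y - x)) w" for x y w
    unfolding \<psi>_def using dif by (simp add: frechet_derivative_translate)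
  have \<psi>V: "apply_field V (\<psi> x) y = - frechet_derivative \<eta> (at (x - y)) (V y)" for x y
    using \<eta>(5)[of "x - y"] by (simp add: apply_field_def \<psi>d)
  have \<psi>s: "\<psi> x y = \<eta> (x - y)" for x y
    using \<eta>(3)[of "x - y"] by (simp add: \<psi>_def)
  have UV: "(\<Sum>j\<in>UNIV. U j y * d\<eta> j (x - y)) = - apply_field V (\<psi> x) y"
      "F y * (\<Sum>j\<in>UNIV. U j y * d\<eta> j (x - y)) = - (f y * apply_field V (\<psi> x) y)" if "norm x \<le> R" for x y
  proof -
    have "d\<eta> j (x - y) = 0 \<or> cut y = 1" for j
      using that v1[of x y j] tri(1)[of y x] cut1[of y] by force
    then have "cut y = 1 \<or> (\<forall>j. d\<eta> j (x - y) = 0)" by blast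
    then show "(\<Sum>j\<in>UNIV. U j y * d\<eta> j (x - y)) = - apply_field V (\<psi> x) y"
      "F y * (\<Sum>j\<in>UNIV. U j y * d\<eta> j (x - y)) = - (f y * apply_field V (\<psi> x) y)"
      by (auto simp: \<psi>V D\<eta> U_def F_def)
  qed
  \<comment> \<open>In \<open>a1\<close>, \<open>b1\<close> and \<open>c1\<close> all factors except
    the kernel depend on one variable only. The kernel integrates to \<open>1\<close> in the other
    one, so these terms reproduce the left-hand side of the claim.\<close>
  have "(\<integral>y. a1 (x, y) \<partial>lborel) = f x * g' x * \<phi> x" for x
    by (cases "\<phi> x = 0") (simp_all add: a1_def x1 F_def cut\<phi>)
  then have a1: "(\<integral>z. a1 z \<partial>lborel) = (\<integral>x. f x * g' x * \<phi> x \<partial>lborel)"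
    by (simp add: iterated_integrals(1)[OF int(1), symmetric])
  have "(\<integral>x. b1 (x, y) \<partial>lborel) = f' y * g y * \<phi> y" for y
    by (cases "\<phi> y = 0") (simp_all add: b1_def y1 G_def cut\<phi>)
  then have b1: "(\<integral>z. b1 z \<partial>lborel) = (\<integral>x. f' x * g x * \<phi> x \<partial>lborel)"
    by (simp add: iterated_integrals(2)[OF int(3), symmetric])
  have Vc: "F x * G x * (\<Sum>j\<in>UNIV. U j x * d\<phi> j x) = f x * g x * apply_field V \<phi> x"
      "G x * (\<Sum>j\<in>UNIV. U j x * d\<phi> j x) = g x * apply_field V \<phi> x" for x
  proof -
    have "d\<phi> j x = 0 \<or> cut x = 1" for j using v0[of x j] cut1[of x] by force
    then have "cut x = 1 \<or> (\<forall>j. d\<phi> j x = 0)" by blast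
    then show "F x * G x * (\<Sum>j\<in>UNIV. U j x * d\<phi> j x) = f x * g x * apply_field V \<phi> x"
      "G x * (\<Sum>j\<in>UNIV. U j x * d\<phi> j x) = g x * apply_field V \<phi> x"
      by (auto simp: A\<phi> U_def F_def G_def)
  qed
  have c1: "(\<integral>z. c1 z \<partial>lborel) = (\<integral>x. f x * g x * apply_field V \<phi> x \<partial>lborel)"
  proof -
    have "(\<integral>y. c1 (x, y) \<partial>lborel) = f x * g x * apply_field V \<phi> x" for x
      by (simp add: c1_def x1 Vc)
    then show ?thesis by (simp add: iterated_integrals(1)[OF int(5), symmetric])
  qed
  \<comment> \<open>The field is frozen at \<open>x\<close>, so the \<open>y\<close>-integral is
    that of a directional derivative with a constant direction.\<close>
  have "(\<integral>y. d1 (x, y) \<partial>lborel) = 0" for x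
  proof -
    let ?w = "\<chi> j. U j x"
    have "(\<integral>y. frechet_derivative \<eta> (at (x - y)) ?w \<partial>lborel) = (\<integral>y. - frechet_derivative \<eta> (at (y + (- x))) ?w \<partial>lborel)"
      using \<eta>(5)[of "y - x" for y] by (intro Bochner_Integration.integral_cong) auto
    also have "\<dots> = - (\<integral>y. frechet_derivative \<eta> (at y) ?w \<partial>lborel)"
      using lborel_integral_translate[of "\<lambda>y. frechet_derivative \<eta> (at y) ?w" "- x"]
        Ck1_continuous(2)[OF diff(1)] by (simp add: borel_measurable_continuous_onI)
    also have "\<dots> = 0" by (simp add: integral_directional_derivative[OF diff(1) \<eta>(2)])
    finally show ?thesis by (simp add: d1_def D\<eta>)
  qed
  then have d1: "(\<integral>z. d1 z \<partial>lborel) = 0"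
    by (simp add: iterated_integrals(1)[OF int(7), symmetric])
  \<comment> \<open>Here the field is evaluated at the integration variable \<open>y\<close>, and
    the integral vanishes because \<open>V\<close> is divergence free.\<close>
  have "(\<integral>y. e1 (x, y) \<partial>lborel) = 0" for x
  proof (cases "\<phi> x = 0")
    case False
    have "Ck (Suc 0) (\<psi> x)" using \<psi> by (auto simp: smooth_def)
    from integral_apply_field[OF diff(3) V(2) this \<psi>v] show ?thesis
      using \<phi>0[OF False] by (simp add: e1_def UV)
  qed (simp add: e1_def)
  then have e1: "(\<integral>z. e1 z \<partial>lborel) = 0"
    by (simp add: iterated_integrals(1)[OF int(9), symmetric])
  \<comment> \<open>This is the weak equation for \<open>f\<close>, tested in \<open>y\<close>
    against the kernel centred at \<open>x\<close>.\<close>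
  have "(\<integral>y. b2 (x, y) \<partial>lborel) = (\<integral>y. e2 (x, y) \<partial>lborel)" for x
  proof (cases "\<phi> x = 0")
    case False
    have "(\<integral>y. e2 (x, y) \<partial>lborel) = (\<integral>y. G x * \<phi> x * (F y * (\<Sum>j\<in>UNIV. U j y * d\<eta> j (x - y))) \<partial>lborel)"
      by (simp add: e2_def mult_ac)
    also have "\<dots> = G x * \<phi> x * - (\<integral>y. f y * apply_field V (\<psi> x) y \<partial>lborel)"
      unfolding UV(2)[OF \<phi>0[OF False]] by simp
    also have "\<dots> = G x * \<phi> x * (\<integral>y. f' y * \<psi> x y \<partial>lborel)"
      by (simp only: Hf[OF \<psi> \<psi>v[OF \<phi>0[OF False]]])
    also have "\<dots> = (\<integral>y. G x * \<phi> x * (f' y * \<psi> x y) \<partial>lborel)" by simp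
    also have "\<dots> = (\<integral>y. b2 (x, y) \<partial>lborel)"
      by (simp add: b2_def \<psi>s mult_ac)
    finally show ?thesis by simp
  qed (simp add: b2_def e2_def)
  then have b2: "(\<integral>z. b2 z \<partial>lborel) = (\<integral>z. e2 z \<partial>lborel)"
    by (simp add: iterated_integrals(1)[OF int(4), symmetric] iterated_integrals(1)[OF int(10), symmetric])
  \<comment> \<open>This is the weak equation for \<open>g\<close>, tested in \<open>x\<close>
    against \<phi> times the kernel: differentiating the product yields the \<open>c2\<close> and
    \<open>d2\<close> terms, and \<open>a2\<close> carries \<open>g'\<close>.\<close>
  have "(\<integral>x. a2 (x, y) + c2 (x, y) + d2 (x, y) \<partial>lborel) = 0" for y
  proof -
    define \<xi> where "\<xi> x = \<phi> x * \<psi> y x" for x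
    have \<xi>: "smooth \<xi>" "vanishes_outside R \<xi>" "vanishes_outside (R + 1) \<xi>"
      using smooth_mult[OF \<phi>(1) \<psi>] \<phi>(2) by (auto simp: \<xi>_def[abs_def] vanishes_outside_def)
    then have C\<xi>: "Ck m \<xi>" for m by (simp add: smooth_def)
    have A\<xi>: "apply_field V \<xi> x = \<phi> x * frechet_derivative \<eta> (at (x - y)) (V x) + apply_field V \<phi> x * \<psi> y x" for x
    proof -
      have "\<psi> y differentiable (at x)" using \<psi>[of y] Ck.simps(2) unfolding smooth_def by blast
      then show ?thesis
        unfolding apply_field_def \<xi>_def[abs_def] by (simp add: frechet_derivative_mult[OF dif(2)] \<psi>d)
    qed
    have "a2 (x, y) + c2 (x, y) + d2 (x, y) = F y * (g' x * \<xi> x + g x * apply_field V \<xi> x)" for x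
    proof -
      have d: "G x * \<phi> x * (\<Sum>j\<in>UNIV. U j x * d\<eta> j (x - y)) = g x * \<phi> x * frechet_derivative \<eta> (at (x - y)) (V x)"
        by (cases "\<phi> x = 0") (auto simp: cut\<phi> G_def U_def D\<eta>)
      have "a2 (x, y) + c2 (x, y) + d2 (x, y) = F y * (g' x * (\<phi> x * \<eta> (x - y))
          + G x * (\<Sum>j\<in>UNIV. U j x * d\<phi> j x) * \<eta> (x - y) + G x * \<phi> x * (\<Sum>j\<in>UNIV. U j x * d\<eta> j (x - y)))"
        by (simp add: a2_def c2_def d2_def algebra_simps)
      also have "\<dots> = F y * (g' x * \<xi> x + g x * apply_field V \<xi> x)"
        unfolding d Vc A\<xi> by (simp add: \<xi>_def \<psi>_def algebra_simps)
      finally show ?thesis .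
    qed
    moreover have "integrable lborel (\<lambda>x. g' x * \<xi> x)"
      using bounded_borel_mult[OF fg(4) bounded_borel_continuous[OF _ \<xi>(2)]] C\<xi>[of 0] \<xi>(2)
      by (intro integrable_bounded_borel[of _ R]) (auto simp: vanishes_outside_def)
    moreover have "integrable lborel (\<lambda>x. g x * apply_field V \<xi> x)"
      using vanishes_outside_apply_field[OF \<xi>(2), of V] apply_field_continuous[OF C(3)[of 0] C\<xi>]
      by (intro integrable_vanishes_outside[of _ R] continuous_intros fg) (auto simp: vanishes_outside_def)
    ultimately show ?thesis using Hg[OF \<xi>(1,3)] by simp
  qed
  then have "(\<integral>z. a2 z + c2 z + d2 z \<partial>lborel) = 0"
    using int by (subst iterated_integrals(2)[symmetric]) simp_all
  then have acd: "(\<integral>z. a2 z \<partial>lborel) + (\<integral>z. c2 z \<partial>lborel) + (\<integral>z. d2 z \<partial>lborel) = 0"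
    using int by simp
  have "integrable lborel (\<lambda>x. f' x * (g x * \<phi> x))" "integrable lborel (\<lambda>x. g' x * (f x * \<phi> x))"
  proof -
    have "vanishes_outside R (\<lambda>x. g x * \<phi> x)" "vanishes_outside R (\<lambda>x. f x * \<phi> x)"
      using \<phi>(2) by (auto simp: vanishes_outside_def)
    moreover from this have "bounded_borel (\<lambda>x. g x * \<phi> x)" "bounded_borel (\<lambda>x. f x * \<phi> x)"
      using Ck1_continuous(1)[OF diff(2)] fg by (auto intro!: bounded_borel_continuous continuous_intros)
    ultimately show "integrable lborel (\<lambda>x. f' x * (g x * \<phi> x))" "integrable lborel (\<lambda>x. g' x * (f x * \<phi> x))"
      using fg by (auto intro!: integrable_bounded_borel[of _ R] bounded_borel_mult simp: vanishes_outside_def)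
  qed
  then have "(\<integral>x. f' x * g x * \<phi> x + f x * g' x * \<phi> x \<partial>lborel)
      = (\<integral>x. f' x * g x * \<phi> x \<partial>lborel) + (\<integral>x. f x * g' x * \<phi> x \<partial>lborel)"
    by (intro Bochner_Integration.integral_add) (simp_all add: mult_ac)
  moreover have "(\<integral>z. k z \<partial>lborel) = ((\<integral>z. a1 z \<partial>lborel) - (\<integral>z. a2 z \<partial>lborel))
      + ((\<integral>z. b1 z \<partial>lborel) - (\<integral>z. b2 z \<partial>lborel)) + ((\<integral>z. c1 z \<partial>lborel) - (\<integral>z. c2 z \<partial>lborel))
      + ((\<integral>z. d1 z \<partial>lborel) - (\<integral>z. d2 z \<partial>lborel)) - ((\<integral>z. e1 z \<partial>lborel) - (\<integral>z. e2 z \<partial>lborel))"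
    unfolding keq' using int by simp
  ultimately show "(\<integral>x. (f' x * g x + f x * g' x) * \<phi> x \<partial>lborel) + (\<integral>x. f x * g x * apply_field V \<phi> x \<partial>lborel)
      = (\<integral>z. k z \<partial>lborel)"
    using a1 b1 c1 d1 e1 b2 acd by (simp add: distrib_right)
qed

section \<open>Moduli of continuity, Lipschitz bounds and the limit of the defect\<close>

lemma uniform_modulus:
  fixes f :: "'a::euclidean_space \<Rightarrow> real"
  assumes "continuous_on UNIV f" "\<delta> > 0"
  obtains s where "s > 0" "\<And>x y. norm x \<le> R \<Longrightarrow> norm (x - y) \<le> s \<Longrightarrow> \<bar>f x - f y\<bar> \<le> \<delta>"
proof -
  have "uniformly_continuous_on (cball 0 (R + 1)) f"
    by (intro compact_uniformly_continuous continuous_on_subset[OF assms(1)]) auto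
  then obtain t where t: "t > 0"
    "\<And>x y. x \<in> cball 0 (R + 1) \<Longrightarrow> y \<in> cball 0 (R + 1) \<Longrightarrow> dist y x < t \<Longrightarrow> dist (f y) (f x) < \<delta>"
    using assms(2) unfolding uniformly_continuous_on_def by metis
  show thesis
  proof (rule that[of "min 1 (t/2)"])
    fix x y :: 'a assume x: "norm x \<le> R" and xy: "norm (x - y) \<le> min 1 (t / 2)"
    have "norm y \<le> norm x + norm (x - y)" by norm
    then have "x \<in> cball 0 (R + 1)" "y \<in> cball 0 (R + 1)" using x xy by auto
    moreover have "dist y x < t" using xy t(1) by (simp add: dist_norm norm_minus_commute)
    ultimately have "dist (f y) (f x) < \<delta>" by (rule t(2))
    then show "\<bar>f x - f y\<bar> \<le> \<delta>" by (simp add: dist_real_def abs_minus_commute)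
  qed (use t in auto)
qed

lemma Ck1_lipschitz_real:
  fixes u :: "real ^ 'n \<Rightarrow> real"
  assumes "Ck (Suc 0) u"
  obtains L where "\<And>x y. norm x \<le> R \<Longrightarrow> norm y \<le> R \<Longrightarrow> \<bar>u x - u y\<bar> \<le> L * norm (x - y)"
proof -
  have "\<exists>B. \<forall>x. norm x \<le> R \<longrightarrow> \<bar>frechet_derivative u (at x) (axis j 1)\<bar> \<le> B" for j
    using bounded_on_cball[OF Ck1_continuous(2)[OF assms, of "axis j 1"], of R] unfolding real_norm_def by metis
  then obtain B where B: "\<And>j x. norm x \<le> R \<Longrightarrow> \<bar>frechet_derivative u (at x) (axis j 1)\<bar> \<le> B j"
    by metis
  have u: "u differentiable (at x)" for x using assms by simp
  have "\<bar>u x - u y\<bar> \<le> (\<Sum>j\<in>UNIV. B j) * norm (x - y)" if "norm x \<le> R" "norm y \<le> R" for x y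
  proof -
    have on: "onorm (frechet_derivative u (at z)) \<le> (\<Sum>j\<in>UNIV. B j)" if "norm z \<le> R" for z
    proof (rule onorm_bound)
      have "B j \<ge> 0" for j using order_trans[OF abs_ge_zero B[OF that]] .
      then show "0 \<le> (\<Sum>j\<in>UNIV. B j)" by (intro sum_nonneg) auto
      fix w :: "real ^ 'n"
      have "\<bar>frechet_derivative u (at z) w\<bar> \<le> (\<Sum>j\<in>UNIV. \<bar>w $ j * frechet_derivative u (at z) (axis j 1)\<bar>)"
        unfolding frechet_derivative_sum_axis[OF u, of z w] by (rule sum_abs)
      also have "\<dots> \<le> (\<Sum>j\<in>UNIV. norm w * B j)"
        unfolding abs_mult using B[OF that] component_le_norm_cart
        by (intro sum_mono mult_mono) auto
      also have "\<dots> = (\<Sum>j\<in>UNIV. B j) * norm w"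
        unfolding sum_distrib_left[symmetric] by (rule mult.commute)
      finally show "norm (frechet_derivative u (at z) w) \<le> (\<Sum>j\<in>UNIV. B j) * norm w"
        by simp
    qed
    have "norm (u x - u y) \<le> (\<Sum>j\<in>UNIV. B j) * norm (x - y)"
    proof (rule differentiable_bound[of "cball 0 R" u "\<lambda>z. frechet_derivative u (at z)"])
      show "(u has_derivative frechet_derivative u (at z)) (at z within cball 0 R)" for z
        using u by (simp add: frechet_derivative_works has_derivative_at_withinI)
    qed (use that on in auto)
    then show ?thesis by simp
  qed
  with that show thesis by blast
qed

lemma Ck1_lipschitz:
  fixes V :: "real ^ 'n \<Rightarrow> real ^ 'm"
  assumes "Ck (Suc 0) V"
  obtains L where "L \<ge> 0" "\<And>x y. norm x \<le> R \<Longrightarrow> norm y \<le> R \<Longrightarrow> norm (V x - V y) \<le> L * norm (x - y)"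
proof -
  have "\<exists>L. \<forall>x y. norm x \<le> R \<longrightarrow> norm y \<le> R \<longrightarrow> \<bar>V x $ j - V y $ j\<bar> \<le> L * norm (x - y)" for j
    using Ck1_lipschitz_real[OF Ck_vec_nth[OF assms, of j], of R] by metis
  then obtain L where L: "\<And>j x y. norm x \<le> R \<Longrightarrow> norm y \<le> R \<Longrightarrow> \<bar>V x $ j - V y $ j\<bar> \<le> L j * norm (x - y)"
    by metis
  show thesis
  proof (rule that[of "\<bar>\<Sum>j\<in>UNIV. L j\<bar>"])
    fix x y :: "real ^ 'n" assume xy: "norm x \<le> R" "norm y \<le> R"
    have "norm (V x - V y) \<le> (\<Sum>j\<in>UNIV. \<bar>(V x - V y) $ j\<bar>)" by (rule norm_le_l1_cart)
    also have "\<dots> \<le> (\<Sum>j\<in>UNIV. L j * norm (x - y))"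
      using L[OF xy] by (intro sum_mono) simp
    also have "\<dots> \<le> \<bar>\<Sum>j\<in>UNIV. L j\<bar> * norm (x - y)"
      unfolding sum_distrib_right[symmetric] by (intro mult_right_mono) auto
    finally show "norm (V x - V y) \<le> \<bar>\<Sum>j\<in>UNIV. L j\<bar> * norm (x - y)" .
  qed simp
qed

text \<open>The difference of the two sides does not depend on the mollifier, whereas the defect
  integral that equals it can be made arbitrarily small. The weak equations are assumed on radius
  \<open>R + 1\<close> because the kernel enlarges the support of \<phi> by at most
  \<open>1\<close>.\<close>

lemma product_rule_bounded:
  fixes V :: "real ^ 'n \<Rightarrow> real ^ 'n" and f g f' g' \<phi> :: "real ^ 'n \<Rightarrow> real"
  assumes V: "smooth V" "\<And>x. divergence V x = 0"
    and fg: "continuous_on UNIV f" "continuous_on UNIV g" "bounded_borel f'" "bounded_borel g'"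
    and \<phi>: "smooth \<phi>" "vanishes_outside R \<phi>"
    and Hf: "\<And>\<psi>. smooth \<psi> \<Longrightarrow> vanishes_outside (R + 1) \<psi> \<Longrightarrow>
        (\<integral>x. f' x * \<psi> x \<partial>lborel) = - (\<integral>x. f x * apply_field V \<psi> x \<partial>lborel)"
    and Hg: "\<And>\<psi>. smooth \<psi> \<Longrightarrow> vanishes_outside (R + 1) \<psi> \<Longrightarrow>
        (\<integral>x. g' x * \<psi> x \<partial>lborel) = - (\<integral>x. g x * apply_field V \<psi> x \<partial>lborel)"
  shows "(\<integral>x. (f' x * g x + f x * g' x) * \<phi> x \<partial>lborel) = - (\<integral>x. f x * g x * apply_field V \<phi> x \<partial>lborel)"
proof -
  define I where "I = (\<integral>x. (f' x * g x + f x * g' x) * \<phi> x \<partial>lborel) + (\<integral>x. f x * g x * apply_field V \<phi> x \<partial>lborel)"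
  obtain K where K: "K > 0"
    "\<And>\<epsilon>. 0 < \<epsilon> \<Longrightarrow> \<exists>\<eta> :: real ^ 'n \<Rightarrow> real. smooth \<eta> \<and> vanishes_outside \<epsilon> \<eta> \<and>
      (\<forall>x. \<eta> (- x) = \<eta> x) \<and> (\<forall>x v. frechet_derivative \<eta> (at (- x)) v = - frechet_derivative \<eta> (at x) v) \<and>
      (\<integral>x. \<eta> x \<partial>lborel) = 1 \<and>
      (\<forall>x. \<bar>\<eta> x\<bar> * measure lborel (cball (0::real ^ 'n) \<epsilon>) \<le> K) \<and>
      (\<forall>x v. \<bar>frechet_derivative \<eta> (at x) v\<bar> * measure lborel (cball (0::real ^ 'n) \<epsilon>) \<le> K * norm v / \<epsilon>)"
    using mollifiers by metis
  have C: "Ck m \<phi>" "Ck m V" for m using \<phi> V by (auto simp: smooth_def)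
  have c\<phi>: "continuous_on UNIV \<phi>" using C(1)[of 0] by simp
  have vA: "vanishes_outside R (apply_field V \<phi>)" by (rule vanishes_outside_apply_field[OF \<phi>(2)])
  \<comment> \<open>The first variable ranges over radius \<open>R + 1\<close> and the second is at
    distance at most \<open>1\<close> from it, hence \<open>R + 2\<close>.\<close>
  obtain L where L: "L \<ge> 0" "\<And>x y. norm x \<le> R + 2 \<Longrightarrow> norm y \<le> R + 2 \<Longrightarrow> norm (V x - V y) \<le> L * norm (x - y)"
    using Ck1_lipschitz[OF C(2), of "R + 2"] by metis
  obtain B1 B2 where B1: "\<And>x. \<bar>f' x\<bar> \<le> B1" and B2: "\<And>x. \<bar>g' x\<bar> \<le> B2"
    using fg by (auto simp: bounded_borel_def)
  obtain B3 where B3: "\<And>x. \<bar>\<phi> x\<bar> \<le> B3"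
    using vanishes_outside_bounded[OF c\<phi> \<phi>(2)] unfolding real_norm_def by metis
  obtain B4 where B4: "\<And>x. \<bar>apply_field V \<phi> x\<bar> \<le> B4"
    using vanishes_outside_bounded[OF apply_field_continuous[OF C(2) C(1)] vA] unfolding real_norm_def by metis
  obtain B5 where B5: "\<And>x. norm x \<le> R + 1 \<Longrightarrow> \<bar>g x\<bar> \<le> B5"
    using bounded_on_cball[OF fg(2), of "R + 1"] unfolding real_norm_def by metis
  define B where "B = max B1 (max B2 (max B3 (max B4 B5)))"
  have B: "\<bar>f' x\<bar> \<le> B" "\<bar>g' x\<bar> \<le> B" "\<bar>\<phi> x\<bar> \<le> B" "\<bar>apply_field V \<phi> x\<bar> \<le> B"
    "norm x \<le> R + 1 \<Longrightarrow> \<bar>g x\<bar> \<le> B" for x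
    using B1[of x] B2[of x] B3[of x] B4[of x] B5[of x] by (auto simp: B_def le_max_iff_disj)
  have B0: "B \<ge> 0" using B(1)[of 0] by linarith
  define N where "N = K * L"
  have N0: "N \<ge> 0" using K(1) L(1) by (simp add: N_def)
  \<comment> \<open>The four summands bound the four terms of the defect after division by \<delta>;
    the volume is that of the ball in which \<open>x\<close> ranges.\<close>
  define M where "M = (B * B * K + B * K + B * B * K + B * B * N) * measure lborel (cball (0::real ^ 'n) (R + 1))"
  have small: "\<bar>I\<bar> \<le> \<delta> * M" if \<delta>: "\<delta> > 0" for \<delta>
  proof -
    obtain s1 where s1: "s1 > 0" "\<And>x y. norm x \<le> R + 1 \<Longrightarrow> norm (x - y) \<le> s1 \<Longrightarrow> \<bar>f x - f y\<bar> \<le> \<delta>"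
      using uniform_modulus[OF fg(1) \<delta>, of "R + 1"] by metis
    have "continuous_on UNIV (\<lambda>x. g x * \<phi> x)" using fg c\<phi> by (intro continuous_intros)
    then obtain s2 where s2: "s2 > 0"
      "\<And>x y. norm x \<le> R + 1 \<Longrightarrow> norm (x - y) \<le> s2 \<Longrightarrow> \<bar>g x * \<phi> x - g y * \<phi> y\<bar> \<le> \<delta>"
      using uniform_modulus[OF _ \<delta>, of "\<lambda>x. g x * \<phi> x" "R + 1"] by metis
    define \<epsilon> where "\<epsilon> = min 1 (min s1 s2)"
    have \<epsilon>: "0 < \<epsilon>" "\<epsilon> \<le> 1" "\<epsilon> \<le> s1" "\<epsilon> \<le> s2" using s1 s2 by (auto simp: \<epsilon>_def)
    let ?W = "measure lborel (cball (0::real ^ 'n) \<epsilon>)"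
    obtain \<eta> :: "real ^ 'n \<Rightarrow> real" where \<eta>: "smooth \<eta>" "vanishes_outside \<epsilon> \<eta>" "\<And>x. \<eta> (- x) = \<eta> x"
      "(\<integral>x. \<eta> x \<partial>lborel) = 1" "\<And>x v. frechet_derivative \<eta> (at (- x)) v = - frechet_derivative \<eta> (at x) v"
      and \<eta>b: "\<And>x. \<bar>\<eta> x\<bar> * ?W \<le> K" "\<And>x v. \<bar>frechet_derivative \<eta> (at x) v\<bar> * ?W \<le> K * norm v / \<epsilon>"
      using K(2)[OF \<epsilon>(1)] by metis
    define k where "k = (\<lambda>(x, y). (f x - f y) * g' x * \<phi> x * \<eta> (x - y)
      + f' y * (g y * \<phi> y - g x * \<phi> x) * \<eta> (x - y)
      + (f x - f y) * g x * apply_field V \<phi> x * \<eta> (x - y)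
      + (f x - f y) * g x * \<phi> x * frechet_derivative \<eta> (at (x - y)) (V x - V y))"
    have defect: "integrable lborel k" "I = (\<integral>z. k z \<partial>lborel)"
      unfolding k_def I_def
      by (rule product_rule_defect[OF V fg \<phi> \<eta> \<epsilon>(1,2)]; (rule Hf Hg; assumption))+
    have "\<bar>\<integral>z. k z \<partial>lborel\<bar> \<le> \<delta> * (B * B * K + B * K + B * B * K + B * B * N)
        * measure lborel (cball (0::real ^ 'n) (R + 1))"
    proof (rule integral_near_diagonal_le[OF defect(1) _ _ \<epsilon>(1)])
      fix x y :: "real ^ 'n"
      {
        assume x: "norm x \<le> R + 1" and xy: "norm (x - y) \<le> \<epsilon>"
        have "norm y \<le> norm x + norm (x - y)" by norm
        then have y: "norm y \<le> R + 2" using x xy \<epsilon> by linarith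
        have df: "\<bar>f x - f y\<bar> \<le> \<delta>" using s1(2)[OF x] xy \<epsilon> by simp
        have dg: "\<bar>g y * \<phi> y - g x * \<phi> x\<bar> \<le> \<delta>"
          using s2(2)[OF x, of y] xy \<epsilon> by (simp add: abs_minus_commute)
        \<comment> \<open>The increment of the field is at most \<open>L * \<epsilon>\<close>, which
          cancels the \<open>1/\<epsilon>\<close> of the mollifier's derivative. The bound
          \<open>N\<close> is independent of \<epsilon>, and smallness comes from
          \<open>f x - f y\<close> alone.\<close>
        have dV: "\<bar>frechet_derivative \<eta> (at (x - y)) (V x - V y)\<bar> * ?W \<le> N"
        proof -
          have "norm (V x - V y) \<le> L * \<epsilon>"
            using L(2)[OF _ y, of x] x mult_left_mono[OF xy L(1)] by simp
          then have "K * norm (V x - V y) / \<epsilon> \<le> N"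
            using K(1) \<epsilon>(1) by (simp add: N_def field_simps)
          with \<eta>b(2) show ?thesis using order_trans by blast
        qed
        have "\<bar>k (x, y)\<bar> \<le> \<bar>(f x - f y) * g' x * \<phi> x * \<eta> (x - y)\<bar>
           + \<bar>f' y * (g y * \<phi> y - g x * \<phi> x) * \<eta> (x - y)\<bar>
           + \<bar>(f x - f y) * g x * apply_field V \<phi> x * \<eta> (x - y)\<bar>
           + \<bar>(f x - f y) * g x * \<phi> x * frechet_derivative \<eta> (at (x - y)) (V x - V y)\<bar>"
          unfolding k_def prod.case by linarith
        from mult_right_mono[OF this measure_nonneg[of lborel "cball 0 \<epsilon>"]]
        have "\<bar>k (x, y)\<bar> * ?W \<le> \<bar>f x - f y\<bar> * \<bar>g' x\<bar> * \<bar>\<phi> x\<bar> * (\<bar>\<eta> (x - y)\<bar> * ?W)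
           + \<bar>f' y\<bar> * \<bar>g y * \<phi> y - g x * \<phi> x\<bar> * (\<bar>\<eta> (x - y)\<bar> * ?W)
           + \<bar>f x - f y\<bar> * \<bar>g x\<bar> * \<bar>apply_field V \<phi> x\<bar> * (\<bar>\<eta> (x - y)\<bar> * ?W)
           + \<bar>f x - f y\<bar> * \<bar>g x\<bar> * \<bar>\<phi> x\<bar> * (\<bar>frechet_derivative \<eta> (at (x - y)) (V x - V y)\<bar> * ?W)"
          by (simp only: abs_mult distrib_right mult.assoc)
        also have "\<dots> \<le> \<delta> * B * B * K + B * \<delta> * K + \<delta> * B * B * K + \<delta> * B * B * N"
          by (intro add_mono mult_mono df dg dV \<eta>b(1) B x)
            (use \<delta> B0 K(1) in auto)
        finally show "\<bar>k (x, y)\<bar> * ?W \<le> \<delta> * (B * B * K + B * K + B * B * K + B * B * N)"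
          by (simp add: algebra_simps)
      }
      assume far: "R + 1 < norm x \<or> \<epsilon> < norm (x - y)"
      show "k (x, y) = 0"
      proof (cases "\<epsilon> < norm (x - y)")
        case True
        then show ?thesis
          using vanishes_outsideD[OF \<eta>(2)] vanishes_outsideD[OF frechet_derivative_vanishes_outside[OF \<eta>(2)]]
          by (simp add: k_def)
      next
        case False
        have "norm x \<le> norm y + norm (x - y)" by norm
        then have "R < norm x" "R < norm y" using far False \<epsilon>(2) by linarith+
        then show ?thesis
          using vanishes_outsideD[OF \<phi>(2)] vanishes_outsideD[OF vA] by (simp add: k_def)
      qed
    qed
    then show ?thesis unfolding M_def defect(2) by (simp add: mult.assoc)
  qed
  have "I = 0"
  proof (rule ccontr)
    assume I: "I \<noteq> 0"
    have "M \<ge> 0" using small[of 1] by simp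
    then have "0 \<le> M * \<bar>I\<bar>" by simp
    \<comment> \<open>With this \<delta> the estimate reads
      \<open>|I| * (2 * M + 1) \<le> |I| * M\<close>; the \<open>+ 1\<close> keeps the denominator
      positive when \<open>M = 0\<close>.\<close>
    moreover have "\<bar>I\<bar> + M * \<bar>I\<bar> \<le> 0"
      using I \<open>M \<ge> 0\<close> small[of "\<bar>I\<bar> / (2 * M + 1)"] by (simp add: field_simps)
    ultimately show False using I by simp
  qed
  then show ?thesis by (simp add: I_def)
qed

section \<open>Locally bounded derivatives and the general product rule\<close>

lemma distributional_deriv_divergence_free:
  assumes "\<And>x. divergence V x = 0"
  shows "distributional_deriv V f g \<longleftrightarrow>
    (\<forall>\<phi>. test_function \<phi> \<longrightarrow> (\<integral>x. g x * \<phi> x \<partial>lborel) = - (\<integral>x. f x * apply_field V \<phi> x \<partial>lborel))"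
  by (simp add: distributional_deriv_def assms)

text \<open>Setting the value to \<open>0\<close> wherever the essential bound of the ball is
  exceeded changes the function there only on a null set. Integrals against test functions supported
  in the ball are unaffected, and the new function is bounded everywhere.\<close>

lemma Linf_loc_truncate:
  assumes "Linf_loc g"
  obtains h where "bounded_borel h" "AE x in lborel. norm x \<le> R \<longrightarrow> h x = g x"
proof -
  obtain B where B: "AE x in lborel. x \<in> cball 0 R \<longrightarrow> \<bar>g x\<bar> \<le> B"
    using assms compact_cball unfolding Linf_loc_def by metis
  have [measurable]: "g \<in> borel_measurable borel" using assms by (simp add: Linf_loc_def)
  define h where "h x = (if \<bar>g x\<bar> \<le> B then g x else 0)" for x
  have "h \<in> borel_measurable borel" unfolding h_def[abs_def] by measurable
  moreover have "\<bar>h x\<bar> \<le> \<bar>B\<bar>" for x by (auto simp: h_def)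
  ultimately have "bounded_borel h" by (auto simp: bounded_borel_def)
  moreover have "AE x in lborel. norm x \<le> R \<longrightarrow> h x = g x"
    using B by eventually_elim (auto simp: h_def)
  ultimately show thesis by (rule that)
qed

lemma Linf_loc_integral_truncate:
  assumes "Linf_loc g" "bounded_borel h" "AE x in lborel. norm x \<le> R \<longrightarrow> h x = g x"
    and \<psi>: "continuous_on UNIV \<psi>" "vanishes_outside R \<psi>"
  shows "integrable lborel (\<lambda>x. g x * \<psi> x)" "(\<integral>x. g x * \<psi> x \<partial>lborel) = (\<integral>x. h x * \<psi> x \<partial>lborel)"
proof -
  have [measurable]: "g \<in> borel_measurable borel" "h \<in> borel_measurable borel" "\<psi> \<in> borel_measurable borel"
    using assms by (auto simp: Linf_loc_def bounded_borel_def borel_measurable_continuous_onI)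
  have ae: "AE x in lborel. h x * \<psi> x = g x * \<psi> x"
    using assms(3) by eventually_elim (use \<psi>(2) not_le in \<open>auto simp: vanishes_outside_def\<close>)
  have "integrable lborel (\<lambda>x. h x * \<psi> x)"
    using bounded_borel_mult[OF assms(2) bounded_borel_continuous[OF \<psi>]] \<psi>(2)
    by (intro integrable_bounded_borel[of _ R]) (auto simp: vanishes_outside_def)
  then show "integrable lborel (\<lambda>x. g x * \<psi> x)"
    by (rule integrable_cong_AE_imp[OF _ _ ae]) measurable
  show "(\<integral>x. g x * \<psi> x \<partial>lborel) = (\<integral>x. h x * \<psi> x \<partial>lborel)"
    using AE_symmetric[OF ae] by (intro integral_cong_AE) measurable
qed

lemma Linf_loc_integrable:
  assumes "Linf_loc g" "continuous_on UNIV \<psi>" "vanishes_outside R \<psi>"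
  shows "integrable lborel (\<lambda>x. g x * \<psi> x)"
  using Linf_loc_truncate[OF assms(1), of R] Linf_loc_integral_truncate(1)[OF assms(1) _ _ assms(2,3)] by metis

lemma Linf_loc_add:
  assumes "Linf_loc f" "Linf_loc g"
  shows "Linf_loc (\<lambda>x. f x + g x)"
  unfolding Linf_loc_def
proof (intro conjI allI impI)
  show "(\<lambda>x. f x + g x) \<in> borel_measurable borel"
    using assms by (auto simp: Linf_loc_def)
  fix K :: "(real ^ 'a) set" assume "compact K"
  then have "\<exists>A. AE x in lborel. x \<in> K \<longrightarrow> \<bar>f x\<bar> \<le> A" "\<exists>B. AE x in lborel. x \<in> K \<longrightarrow> \<bar>g x\<bar> \<le> B"
    using assms by (simp_all add: Linf_loc_def)
  then obtain A B where "AE x in lborel. x \<in> K \<longrightarrow> \<bar>f x\<bar> \<le> A" "AE x in lborel. x \<in> K \<longrightarrow> \<bar>g x\<bar> \<le> B"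
    by blast
  then have "AE x in lborel. x \<in> K \<longrightarrow> \<bar>f x + g x\<bar> \<le> A + B"
    by eventually_elim auto
  then show "\<exists>B. AE x in lborel. x \<in> K \<longrightarrow> \<bar>f x + g x\<bar> \<le> B" ..
qed

lemma Linf_loc_mult_continuous:
  assumes "Linf_loc f" "continuous_on UNIV c"
  shows "Linf_loc (\<lambda>x. c x * f x)"
  unfolding Linf_loc_def
proof (intro conjI allI impI)
  show "(\<lambda>x. c x * f x) \<in> borel_measurable borel"
    using assms borel_measurable_continuous_onI[OF assms(2)] by (auto simp: Linf_loc_def)
  fix K :: "(real ^ 'a) set" assume K: "compact K"
  then obtain A where A: "AE x in lborel. x \<in> K \<longrightarrow> \<bar>f x\<bar> \<le> A"
    using assms unfolding Linf_loc_def by metis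
  have "bounded (c ` K)"
    by (intro compact_imp_bounded compact_continuous_image K continuous_on_subset[OF assms(2)]) auto
  then obtain B where B: "\<And>x. x \<in> K \<Longrightarrow> \<bar>c x\<bar> \<le> B"
    unfolding bounded_iff by auto
  from A have "AE x in lborel. x \<in> K \<longrightarrow> \<bar>c x * f x\<bar> \<le> B * A"
  proof eventually_elim
    case (elim x)
    show ?case
    proof
      assume "x \<in> K"
      with elim B[of x] show "\<bar>c x * f x\<bar> \<le> B * A"
        unfolding abs_mult by (intro mult_mono) auto
    qed
  qed
  then show "\<exists>B. AE x in lborel. x \<in> K \<longrightarrow> \<bar>c x * f x\<bar> \<le> B" ..
qed

lemma distributional_deriv_mult:
  assumes V: "smooth V" "\<And>x. divergence V x = 0"
    and f: "continuous_on UNIV f" "Linf_loc f'" "distributional_deriv V f f'"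
    and g: "continuous_on UNIV g" "Linf_loc g'" "distributional_deriv V g g'"
  shows "distributional_deriv V (\<lambda>x. f x * g x) (\<lambda>x. g x * f' x + f x * g' x)"
  unfolding distributional_deriv_divergence_free[OF V(2)]
proof (intro allI impI)
  fix \<phi> :: "real ^ 'a \<Rightarrow> real" assume "test_function \<phi>"
  then obtain R where R: "R > 0" "smooth \<phi>" "vanishes_outside R \<phi>" by (rule test_functionE)
  have c: "continuous_on UNIV \<psi>" if "smooth \<psi>" for \<psi> :: "real ^ 'a \<Rightarrow> real"
    using that Ck.simps(1) unfolding smooth_def by blast
  obtain f2 where f2: "bounded_borel f2" "AE x in lborel. norm x \<le> R + 1 \<longrightarrow> f2 x = f' x"
    using Linf_loc_truncate[OF f(2)] by metis
  obtain g2 where g2: "bounded_borel g2" "AE x in lborel. norm x \<le> R + 1 \<longrightarrow> g2 x = g' x"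
    using Linf_loc_truncate[OF g(2)] by metis
  have Hf: "(\<integral>x. f2 x * \<psi> x \<partial>lborel) = - (\<integral>x. f x * apply_field V \<psi> x \<partial>lborel)"
    and Hg: "(\<integral>x. g2 x * \<psi> x \<partial>lborel) = - (\<integral>x. g x * apply_field V \<psi> x \<partial>lborel)"
    if "smooth \<psi>" "vanishes_outside (R + 1) \<psi>" for \<psi>
    using f(3) g(3) test_functionI[OF that]
    unfolding distributional_deriv_divergence_free[OF V(2)]
      Linf_loc_integral_truncate(2)[OF f(2) f2 c[OF that(1)] that(2), symmetric]
      Linf_loc_integral_truncate(2)[OF g(2) g2 c[OF that(1)] that(2), symmetric] by blast+
  have "(\<integral>x. (f2 x * g x + f x * g2 x) * \<phi> x \<partial>lborel) = - (\<integral>x. f x * g x * apply_field V \<phi> x \<partial>lborel)"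
    by (rule product_rule_bounded[OF V f(1) g(1) f2(1) g2(1) R(2,3)]; (rule Hf Hg; assumption))
  moreover have "(\<integral>x. (f2 x * g x + f x * g2 x) * \<phi> x \<partial>lborel) = (\<integral>x. (g x * f' x + f x * g' x) * \<phi> x \<partial>lborel)"
  proof (rule integral_cong_AE)
    have [measurable]: "f \<in> borel_measurable borel" "g \<in> borel_measurable borel" "\<phi> \<in> borel_measurable borel"
        "f' \<in> borel_measurable borel" "g' \<in> borel_measurable borel"
        "f2 \<in> borel_measurable borel" "g2 \<in> borel_measurable borel"
      using f g f2 g2 c[OF R(2)] by (auto simp: Linf_loc_def bounded_borel_def borel_measurable_continuous_onI)
    show "(\<lambda>x. (f2 x * g x + f x * g2 x) * \<phi> x) \<in> borel_measurable lborel"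
      "(\<lambda>x. (g x * f' x + f x * g' x) * \<phi> x) \<in> borel_measurable lborel" by measurable
    show "AE x in lborel. (f2 x * g x + f x * g2 x) * \<phi> x = (g x * f' x + f x * g' x) * \<phi> x"
      using f2(2) g2(2)
    proof eventually_elim
      case (elim x)
      then show ?case using R(3) by (cases "norm x \<le> R") (auto simp: vanishes_outside_def mult.commute)
    qed
  qed
  ultimately show "(\<integral>x. (g x * f' x + f x * g' x) * \<phi> x \<partial>lborel) = - (\<integral>x. f x * g x * apply_field V \<phi> x \<partial>lborel)"
    by simp
qed

section \<open>The chain rule\<close>

lemma distributional_deriv_const:
  assumes "smooth V" "\<And>x. divergence V x = 0"
  shows "distributional_deriv V (\<lambda>_. c) (\<lambda>_. 0)"
  unfolding distributional_deriv_divergence_free[OF assms(2)]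
proof (intro allI impI)
  fix \<phi> :: "real ^ 'a \<Rightarrow> real" assume "test_function \<phi>"
  then obtain R where "smooth \<phi>" "vanishes_outside R \<phi>" by (rule test_functionE)
  then have "(\<integral>x. apply_field V \<phi> x \<partial>lborel) = 0"
    using assms by (intro integral_apply_field) (auto simp: smooth_def simp del: Ck.simps)
  then show "(\<integral>x. 0 * \<phi> x \<partial>lborel) = - (\<integral>x. c * apply_field V \<phi> x \<partial>lborel)" by simp
qed

lemma Linf_loc_const: "Linf_loc (\<lambda>_. c)"
  by (auto simp: Linf_loc_def)

lemma distributional_deriv_power:
  assumes V: "smooth V" "\<And>x. divergence V x = 0"
    and f: "continuous_on UNIV f" "Linf_loc f'" "distributional_deriv V f f'"
  shows "distributional_deriv V (\<lambda>x. f x ^ n) (\<lambda>x. real n * f x ^ (n - 1) * f' x)"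
proof (induction n)
  case 0
  show ?case using distributional_deriv_const[OF V, of 1] by simp
next
  case (Suc n)
  have "Linf_loc (\<lambda>x. real n * f x ^ (n - 1) * f' x)"
    using f by (intro Linf_loc_mult_continuous continuous_intros)
  from distributional_deriv_mult[OF V f continuous_on_power[OF f(1)] this Suc]
  have "distributional_deriv V (\<lambda>x. f x ^ Suc n) (\<lambda>x. f x ^ n * f' x + f x * (real n * f x ^ (n - 1) * f' x))"
    by simp
  moreover have "f x ^ n * f' x + f x * (real n * f x ^ (n - 1) * f' x) = real (Suc n) * f x ^ (Suc n - 1) * f' x" for x
    by (cases n) (simp_all add: algebra_simps)
  ultimately show ?case by simp
qed

lemma distributional_deriv_add:
  assumes V: "smooth V" "\<And>x. divergence V x = 0"
    and f: "continuous_on UNIV f" "Linf_loc f'" "distributional_deriv V f f'"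
    and g: "continuous_on UNIV g" "Linf_loc g'" "distributional_deriv V g g'"
  shows "distributional_deriv V (\<lambda>x. f x + g x) (\<lambda>x. f' x + g' x)"
  unfolding distributional_deriv_divergence_free[OF V(2)]
proof (intro allI impI)
  fix \<phi> :: "real ^ 'a \<Rightarrow> real" assume t: "test_function \<phi>"
  then obtain R where R: "smooth \<phi>" "vanishes_outside R \<phi>" by (rule test_functionE)
  have C: "Ck m \<phi>" "Ck m V" for m using R V by (auto simp: smooth_def)
  have c: "continuous_on UNIV \<phi>" using C(1)[of 0] by simp
  have "continuous_on UNIV (apply_field V \<phi>)" "vanishes_outside R (apply_field V \<phi>)"
    using apply_field_continuous[OF C(2) C(1)] vanishes_outside_apply_field[OF R(2)] by auto
  then have "integrable lborel (\<lambda>x. h x * apply_field V \<phi> x)" if "continuous_on UNIV h" for h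
    using that by (intro integrable_vanishes_outside[of _ R] continuous_intros) (auto simp: vanishes_outside_def)
  then show "(\<integral>x. (f' x + g' x) * \<phi> x \<partial>lborel) = - (\<integral>x. (f x + g x) * apply_field V \<phi> x \<partial>lborel)"
    using Linf_loc_integrable[OF f(2) c R(2)] Linf_loc_integrable[OF g(2) c R(2)] t f g
    unfolding distributional_deriv_divergence_free[OF V(2)] by (simp add: distrib_right)
qed

lemma distributional_deriv_polynomial:
  fixes a :: "nat \<Rightarrow> real"
  assumes V: "smooth V" "\<And>x. divergence V x = 0"
    and f: "continuous_on UNIV f" "Linf_loc f'" "distributional_deriv V f f'"
  shows "distributional_deriv V (\<lambda>x. \<Sum>i\<le>n. a i * f x ^ i) (\<lambda>x. (\<Sum>i\<le>n. a i * (real i * f x ^ (i - 1))) * f' x)"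
proof (induction n)
  case 0
  show ?case using distributional_deriv_const[OF V, of "a 0"] by simp
next
  case (Suc n)
  \<comment> \<open>The scalar multiple is treated as a product with a constant function, whose
    derivative \<open>0\<close> accounts for the summand \<open>f x ^ Suc n * 0\<close>.\<close>
  have "distributional_deriv V (\<lambda>x. a (Suc n) * f x ^ Suc n)
      (\<lambda>x. f x ^ Suc n * 0 + a (Suc n) * (real (Suc n) * f x ^ (Suc n - 1) * f' x))"
    using f by (intro distributional_deriv_mult[OF V _ _ distributional_deriv_const[OF V]]
      distributional_deriv_power[OF V f] Linf_loc_mult_continuous Linf_loc_const continuous_intros)
  then have "distributional_deriv V (\<lambda>x. (\<Sum>i\<le>n. a i * f x ^ i) + a (Suc n) * f x ^ Suc n)
      (\<lambda>x. (\<Sum>i\<le>n. a i * (real i * f x ^ (i - 1))) * f' x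
        + (f x ^ Suc n * 0 + a (Suc n) * (real (Suc n) * f x ^ (Suc n - 1) * f' x)))"
    using f by (intro distributional_deriv_add[OF V _ _ Suc] Linf_loc_add Linf_loc_mult_continuous Linf_loc_const continuous_intros)
  then show ?case by (simp add: algebra_simps)
qed

text \<open>Approximating \<open>F\<close> uniformly would not control its derivative. Approximating
  \<open>F'\<close> by a polynomial and integrating that polynomial controls both on the bounded
  range that \<open>f\<close> takes on the support of \<phi>, and the error is then integrated
  against fixed functions.\<close>

lemma distributional_deriv_chain:
  fixes F F' :: "real \<Rightarrow> real"
  assumes V: "smooth V" "\<And>x. divergence V x = 0"
    and f: "continuous_on UNIV f" "Linf_loc f'" "distributional_deriv V f f'"
    and F: "\<And>t. (F has_real_derivative F' t) (at t)" "continuous_on UNIV F'"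
  shows "distributional_deriv V (\<lambda>x. F (f x)) (\<lambda>x. F' (f x) * f' x)"
  unfolding distributional_deriv_divergence_free[OF V(2)]
proof (intro allI impI)
  fix \<phi> :: "real ^ 'a \<Rightarrow> real" assume t: "test_function \<phi>"
  then obtain R where R: "smooth \<phi>" "vanishes_outside R \<phi>" by (rule test_functionE)
  have C: "Ck m \<phi>" "Ck m V" for m using R V by (auto simp: smooth_def)
  have c: "continuous_on UNIV \<phi>" using C(1)[of 0] by simp
  have cF: "continuous_on UNIV F" using F(1) DERIV_continuous_on by blast
  let ?A = "apply_field V \<phi>"
  have A: "continuous_on UNIV ?A" "vanishes_outside R ?A"
    using apply_field_continuous[OF C(2) C(1)] vanishes_outside_apply_field[OF R(2)] by auto
  have iA: "integrable lborel (\<lambda>x. h (f x) * ?A x)" if "continuous_on UNIV h" for h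
    using A by (intro integrable_vanishes_outside[of _ R] continuous_intros continuous_on_compose2[OF that f(1)])
      (auto simp: vanishes_outside_def)
  have i\<phi>: "integrable lborel (\<lambda>x. h (f x) * (f' x * \<phi> x))" if "continuous_on UNIV h" for h
    using Linf_loc_integrable[OF Linf_loc_mult_continuous[OF f(2) continuous_on_compose2[OF that f(1)]] c R(2)]
    by (simp add: mult.assoc)
  have iA1: "integrable lborel (\<lambda>x. \<bar>?A x\<bar>)" and i\<phi>1: "integrable lborel (\<lambda>x. \<bar>f' x * \<phi> x\<bar>)"
    using iA[of "\<lambda>_. 1"] i\<phi>[of "\<lambda>_. 1"] by (auto simp: integrable_abs)
  obtain M where M: "M > 0" "\<And>x. norm x \<le> R \<Longrightarrow> \<bar>f x\<bar> \<le> M"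
    using bounded_on_cball[OF f(1), of R] unfolding real_norm_def by metis
  define D where "D = (\<integral>x. F' (f x) * (f' x * \<phi> x) \<partial>lborel) + (\<integral>x. F (f x) * ?A x \<partial>lborel)"
  define B where "B = (\<integral>x. \<bar>f' x * \<phi> x\<bar> \<partial>lborel) + M * (\<integral>x. \<bar>?A x\<bar> \<partial>lborel)"
  have small: "\<bar>D\<bar> \<le> e * B" if e: "e > 0" for e
  proof -
    have "continuous_on {-M..M} F'" using F(2) continuous_on_subset by blast
    then obtain q where q: "real_polynomial_function q" "\<And>t. t \<in> {-M..M} \<Longrightarrow> \<bar>F' t - q t\<bar> < e"
      using Stone_Weierstrass_real_polynomial_function[of "{-M..M}" F' e] e by auto
    obtain b n where b: "q = (\<lambda>t. \<Sum>i\<le>n. b i * t ^ i)"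
      using q(1) real_polynomial_function_iff_sum by auto
    \<comment> \<open>Coefficients of the antiderivative \<open>P\<close> of \<open>q\<close> that
      agrees with \<open>F\<close> at \<open>0\<close>.\<close>
    define a where "a i = (if i = 0 then F 0 else b (i - 1) / real i)" for i
    define P where "P t = (\<Sum>i\<le>Suc n. a i * t ^ i)" for t
    have qa: "(\<Sum>i\<le>Suc n. a i * (real i * t ^ (i - 1))) = q t" for t
      by (simp add: b sum.atMost_Suc_shift a_def del: sum.atMost_Suc)
    have cP: "continuous_on UNIV P" "continuous_on UNIV q"
      unfolding P_def[abs_def] b by (intro continuous_intros)+
    have P: "(P has_real_derivative q t) (at t)" for t
    proof -
      have "((\<lambda>t. a i * t ^ i) has_real_derivative a i * (real i * t ^ (i - 1))) (at t)" for i
        using DERIV_cmult[OF DERIV_pow[of i t], of "a i"] by simp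
      then show ?thesis
        unfolding P_def[abs_def] qa[symmetric] by (intro DERIV_sum)
    qed
    have P0: "P 0 = F 0"
      by (simp add: P_def sum.atMost_Suc_shift a_def del: sum.atMost_Suc)
    \<comment> \<open>The difference vanishes at \<open>0\<close> and its derivative is at most
      \<open>e\<close> on the interval, so the mean value inequality gives
      \<open>e * |t|\<close>.\<close>
    have FP: "\<bar>F t - P t\<bar> \<le> e * M" if "\<bar>t\<bar> \<le> M" for t
    proof -
      have "norm ((F t - P t) - (F 0 - P 0)) \<le> e * norm (t - 0)"
      proof (rule field_differentiable_bound[of "{-M..M}" "\<lambda>t. F t - P t" "\<lambda>t. F' t - q t"])
        show "((\<lambda>t. F t - P t) has_field_derivative F' z - q z) (at z within {- M..M})" for z
          by (rule has_field_derivative_at_within[OF DERIV_diff[OF F(1) P]])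
        show "norm (F' z - q z) \<le> e" if "z \<in> {-M..M}" for z
          using q(2)[OF that] by simp
      qed (use that M in auto)
      also have "\<dots> \<le> e * M" using that e by simp
      finally show ?thesis by (simp add: P0)
    qed
    have "distributional_deriv V (\<lambda>x. P (f x)) (\<lambda>x. q (f x) * f' x)"
      using distributional_deriv_polynomial[where n="Suc n" and a=a, OF V f] unfolding P_def[symmetric] qa .
    then have PQ: "(\<integral>x. q (f x) * (f' x * \<phi> x) \<partial>lborel) + (\<integral>x. P (f x) * ?A x \<partial>lborel) = 0"
      using t unfolding distributional_deriv_divergence_free[OF V(2)] by (simp add: mult.assoc)
    have "D = (\<integral>x. (F' (f x) - q (f x)) * (f' x * \<phi> x) \<partial>lborel) + (\<integral>x. (F (f x) - P (f x)) * ?A x \<partial>lborel)"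
      using PQ i\<phi>[OF F(2)] i\<phi>[OF cP(2)] iA[OF cF] iA[OF cP(1)] by (simp add: D_def left_diff_distrib)
    moreover have "\<bar>\<integral>x. (F' (f x) - q (f x)) * (f' x * \<phi> x) \<partial>lborel\<bar> \<le> (\<integral>x. e * \<bar>f' x * \<phi> x\<bar> \<partial>lborel)"
    proof -
      have "\<bar>(F' (f x) - q (f x)) * (f' x * \<phi> x)\<bar> \<le> e * \<bar>f' x * \<phi> x\<bar>" for x
      proof (cases "norm x \<le> R")
        case True
        then have "\<bar>F' (f x) - q (f x)\<bar> \<le> e" using q(2)[of "f x"] M(2)[of x] by (auto simp: abs_le_iff)
        then show ?thesis unfolding abs_mult[of "F' (f x) - q (f x)"] by (intro mult_right_mono) auto
      qed (use R(2) in \<open>simp add: vanishes_outside_def\<close>)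
      then show ?thesis using i\<phi>1 by (intro integral_abs_le) auto
    qed
    moreover have "\<bar>\<integral>x. (F (f x) - P (f x)) * ?A x \<partial>lborel\<bar> \<le> (\<integral>x. (e * M) * \<bar>?A x\<bar> \<partial>lborel)"
    proof -
      have "\<bar>(F (f x) - P (f x)) * ?A x\<bar> \<le> (e * M) * \<bar>?A x\<bar>" for x
      proof (cases "norm x \<le> R")
        case True
        then show ?thesis unfolding abs_mult by (intro mult_right_mono FP M) auto
      qed (use A(2) in \<open>simp add: vanishes_outside_def\<close>)
      then show ?thesis using iA1 by (intro integral_abs_le) auto
    qed
    ultimately show ?thesis unfolding B_def by (simp add: distrib_left mult.assoc)
  qed
  have "D = 0"
  proof (rule ccontr)
    assume D: "D \<noteq> 0"
    have "B \<ge> 0" using small[of 1] by simp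
    then have "0 \<le> B * \<bar>D\<bar>" by simp
    moreover have "\<bar>D\<bar> + B * \<bar>D\<bar> \<le> 0"
      using D \<open>B \<ge> 0\<close> small[of "\<bar>D\<bar> / (2 * B + 1)"] by (simp add: field_simps)
    ultimately show False using D by simp
  qed
  then show "(\<integral>x. F' (f x) * f' x * \<phi> x \<partial>lborel) = - (\<integral>x. F (f x) * ?A x \<partial>lborel)"
    by (simp add: D_def mult.assoc)
qed

lemma has_gradient_mult:
  assumes X: "\<And>i. smooth (X i)" "\<And>i x. divergence (X i) x = 0"
    and f: "continuous_on UNIV f" "has_gradient X f G"
    and g: "continuous_on UNIV g" "has_gradient X g H"
  shows "has_gradient X (\<lambda>x. f x * g x) (\<lambda>x. g x *\<^sub>R G x + f x *\<^sub>R H x)"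
  using f g distributional_deriv_mult[OF X] unfolding has_gradient_def
  by (auto intro!: Linf_loc_add Linf_loc_mult_continuous)

lemma has_gradient_chain:
  fixes F F' :: "real \<Rightarrow> real"
  assumes X: "\<And>i. smooth (X i)" "\<And>i x. divergence (X i) x = 0"
    and f: "continuous_on UNIV f" "has_gradient X f G"
    and F: "\<And>t. (F has_real_derivative F' t) (at t)" "continuous_on UNIV F'"
  shows "has_gradient X (\<lambda>x. F (f x)) (\<lambda>x. F' (f x) *\<^sub>R G x)"
  using f distributional_deriv_chain[OF X f(1) _ _ F] continuous_on_compose2[OF F(2) f(1)] unfolding has_gradient_def
  by (auto intro!: Linf_loc_mult_continuous)

section \<open>The inequality\<close>

lemma max_powr_has_derivative:
  fixes q :: real
  assumes q: "1 < q"
  shows "((\<lambda>t. max 0 t powr q) has_real_derivative q * max 0 t powr (q - 1)) (at t)"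
proof -
  consider "t < 0" | "t = 0" | "t > 0" by linarith
  then show ?thesis
  proof cases
    case 1
    have "((\<lambda>_. 0) has_real_derivative 0) (at t)" by simp
    then have "((\<lambda>t. max 0 t powr q) has_real_derivative 0) (at t)"
      by (rule has_field_derivative_transform_within_open[where S="{..<0}"]) (use 1 in auto)
    then show ?thesis using 1 by simp
  next
    case 2
    have "((\<lambda>h::real. max 0 h powr q / h) \<longlongrightarrow> 0) (at_left 0)"
      by (rule tendsto_eventually) (auto simp: eventually_at_filter)
    moreover have "((\<lambda>h::real. h powr q / h) \<longlongrightarrow> 0) (at_right 0)"
      using q by real_asymp
    then have "((\<lambda>h::real. max 0 h powr q / h) \<longlongrightarrow> 0) (at_right 0)"
      by (rule Lim_transform_eventually) (auto simp: eventually_at_filter max_def)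
    ultimately have "((\<lambda>h::real. max 0 h powr q / h) \<longlongrightarrow> 0) (at 0)"
      by (rule filterlim_split_at)
    then show ?thesis using 2 by (simp add: DERIV_def)
  next
    case 3
    have "((\<lambda>t. t powr q) has_real_derivative q * t powr (q - 1)) (at t)"
      using 3 by (rule has_real_derivative_powr)
    then have "((\<lambda>t. max 0 t powr q) has_real_derivative q * t powr (q - 1)) (at t)"
      by (rule has_field_derivative_transform_within_open[where S="{0<..}"]) (use 3 in auto)
    then show ?thesis using 3 by (simp add: max_def)
  qed
qed

lemma continuous_on_max_powr:
  fixes q :: real
  assumes "0 < q" "continuous_on S f"
  shows "continuous_on S (\<lambda>x. max 0 (f x) powr q)"
  using assms by (intro continuous_on_powr' continuous_intros) auto

text \<open>Splitting into positive and negative part reduces the only delicate point,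
  \<open>t = 0\<close>, to the one-sided power. In this form of the derivative continuity is
  visible, as the chain rule requires.\<close>

lemma abs_powr_has_derivative:
  fixes q :: real
  assumes q: "1 < q"
  shows "((\<lambda>t. \<bar>t\<bar> powr q) has_real_derivative q * (max 0 t powr (q - 1) - max 0 (- t) powr (q - 1))) (at t)"
proof -
  have "((\<lambda>t. max 0 (- t) powr q) has_real_derivative q * max 0 (- t) powr (q - 1) * (- 1)) (at t)"
    by (rule DERIV_chain2[OF max_powr_has_derivative[OF q]]) (auto intro!: derivative_eq_intros)
  from DERIV_add[OF max_powr_has_derivative[OF q] this]
  have "((\<lambda>t. max 0 t powr q + max 0 (- t) powr q) has_real_derivative
      q * (max 0 t powr (q - 1) - max 0 (- t) powr (q - 1))) (at t)"
    by (simp add: algebra_simps)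
  moreover have "(\<lambda>t. max 0 t powr q + max 0 (- t) powr q) = (\<lambda>t. \<bar>t\<bar> powr q)"
    by (auto simp: fun_eq_iff max_def abs_if)
  ultimately show ?thesis by simp
qed

text \<open>No conjugate exponent is needed for this form: if \<open>z \<le> \<epsilon> * u\<close>,
  the first term on the right dominates; otherwise \<open>u < z / \<epsilon>\<close>, and the second
  one does.\<close>

lemma young_powr:
  fixes u z \<epsilon> q :: real
  assumes "0 \<le> u" "0 \<le> z" "0 < \<epsilon>" "1 < q"
  shows "u powr (q - 1) * z \<le> \<epsilon> * u powr q + \<epsilon> powr (1 - q) * z powr q"
proof (cases "z \<le> \<epsilon> * u")
  case True
  have "u powr (q - 1) * z \<le> u powr (q - 1) * (\<epsilon> * u)"
    using True by (intro mult_left_mono) auto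
  also have "\<dots> = \<epsilon> * u powr q"
    using assms powr_add[of u "q - 1" 1] by (cases "u = 0") (auto simp: mult_ac)
  also have "\<dots> \<le> \<epsilon> * u powr q + \<epsilon> powr (1 - q) * z powr q" by simp
  finally show ?thesis .
next
  case False
  then have z: "0 < z" using assms by (smt (verit) mult_nonneg_nonneg)
  have "u powr (q - 1) \<le> (z / \<epsilon>) powr (q - 1)"
    using False assms by (intro powr_mono2) (auto simp: field_simps)
  also have "\<dots> = \<epsilon> powr (1 - q) * z powr (q - 1)"
    using assms powr_minus[of \<epsilon> "q - 1"] by (subst powr_divide) (auto simp: divide_inverse mult.commute)
  finally have "u powr (q - 1) * z \<le> \<epsilon> powr (1 - q) * z powr (q - 1) * z"
    using z by (intro mult_right_mono) auto
  also have "\<dots> = \<epsilon> powr (1 - q) * z powr q"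
    using z powr_add[of z "q - 1" 1] by simp
  also have "\<dots> \<le> \<epsilon> * u powr q + \<epsilon> powr (1 - q) * z powr q" using assms by simp
  finally show ?thesis .
qed

text \<open>To be read with \<open>y = |f|\<close>, \<open>z = |\<nabla>f|\<close> and
  \<open>t = d\<close>. Both terms on the left are \<open>(y * s) powr (q - 1)\<close> times
  \<open>c1 * z\<close> or \<open>c2 * y\<close>, where \<open>s = (1 + t^2) powr (a / 2)\<close>;
  Young's inequality leaves a small multiple of \<open>(y * s) powr q\<close>.\<close>

lemma absorption_bound:
  fixes a q c1 c2 :: real
  assumes a: "0 < a" and q: "1 < q" and c: "0 < c1" "0 < c2"
  obtains K1 K2 where "K1 > 0" "K2 > 0"
    "\<And>y z t. 0 \<le> y \<Longrightarrow> 0 \<le> z \<Longrightarrow> 0 \<le> t \<Longrightarrow>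
      c1 * (y powr (q - 1) * (1 + t\<^sup>2) powr ((q - 1) * a / 2) * z) + c2 * (y powr q * (1 + t\<^sup>2) powr ((q - 1) * a / 2))
      \<le> 1/2 * (y powr q * t powr (q * a)) + K1 * z powr q + K2 * y powr q"
proof -
  define M where "M = (2::real) powr (q * a / 2)"
  \<comment> \<open>Young's inequality is used twice and
    \<open>s powr q \<le> M * (1 + t powr (q * a))\<close>, so the total factor is
    \<open>2 * \<epsilon> * M = 1/2\<close>. The summand \<open>1\<close> in this bound causes the
    extra \<open>1/2\<close> in the coefficient of \<open>y powr q\<close>.\<close>
  define \<epsilon> where "\<epsilon> = 1 / (4 * M)"
  define L where "L = \<epsilon> powr (1 - q)"
  have M: "M > 0" and \<epsilon>: "\<epsilon> > 0" and L: "L > 0" by (simp_all add: M_def \<epsilon>_def L_def)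
  show thesis
  proof (rule that[of "L * c1 powr q" "L * c2 powr q + 1/2"])
    fix y z t :: real assume nn: "0 \<le> y" "0 \<le> z" "0 \<le> t"
    define s where "s = (1 + t\<^sup>2) powr (a / 2)"
    have s: "s > 0" unfolding s_def by (smt (verit) powr_gt_zero zero_le_power2)
    have sq1: "(1 + t\<^sup>2) powr ((q - 1) * a / 2) = s powr (q - 1)"
      by (simp add: s_def powr_powr mult_ac)
    have us: "(y * s) powr r = y powr r * s powr r" for r
      using nn s by (simp add: powr_mult)
    have "s powr q = (1 + t\<^sup>2) powr (q * a / 2)"
      by (simp add: s_def powr_powr mult_ac)
    also have "\<dots> \<le> (2 * max 1 (t\<^sup>2)) powr (q * a / 2)"
      using a q by (intro powr_mono2) auto
    also have "\<dots> = M * max 1 (t\<^sup>2) powr (q * a / 2)"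
      by (simp add: M_def powr_mult)
    also have "max 1 (t\<^sup>2) powr (q * a / 2) \<le> 1 + t powr (q * a)"
    proof (cases "t\<^sup>2 \<le> 1")
      case False
      then have "t > 0" using nn by (cases "t = 0") auto
      then have "t\<^sup>2 = t powr 2" by (simp add: powr_numeral)
      then have "(t\<^sup>2) powr (q * a / 2) = t powr (q * a)" by (simp add: powr_powr)
      then show ?thesis using False by simp
    qed (simp add: max_def)
    finally have sM: "s powr q \<le> M * (1 + t powr (q * a))" using M by simp
    have "c1 * (y powr (q - 1) * s powr (q - 1) * z) = (y * s) powr (q - 1) * (c1 * z)"
      by (simp add: us)
    also have "\<dots> \<le> \<epsilon> * (y * s) powr q + L * (c1 * z) powr q"
      unfolding L_def using nn s c \<epsilon> q by (intro young_powr) auto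
    finally have 1: "c1 * (y powr (q - 1) * s powr (q - 1) * z) \<le> \<epsilon> * (y * s) powr q + L * c1 powr q * z powr q"
      using c nn by (simp add: powr_mult)
    have "c2 * (y powr q * s powr (q - 1)) = (y * s) powr (q - 1) * (c2 * y)"
      using nn powr_add[of y "q - 1" 1] by (cases "y = 0") (simp_all add: us)
    also have "\<dots> \<le> \<epsilon> * (y * s) powr q + L * (c2 * y) powr q"
      unfolding L_def using nn s c \<epsilon> q by (intro young_powr) auto
    finally have 2: "c2 * (y powr q * s powr (q - 1)) \<le> \<epsilon> * (y * s) powr q + L * c2 powr q * y powr q"
      using c nn by (simp add: powr_mult)
    have "2 * \<epsilon> * (y * s) powr q \<le> 2 * \<epsilon> * (y powr q * (M * (1 + t powr (q * a))))"
      unfolding us using sM \<epsilon> by (intro mult_left_mono) auto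
    also have "\<dots> = 1/2 * (y powr q * t powr (q * a)) + 1/2 * y powr q"
      using M by (simp add: \<epsilon>_def field_simps)
    finally show "c1 * (y powr (q - 1) * (1 + t\<^sup>2) powr ((q - 1) * a / 2) * z)
        + c2 * (y powr q * (1 + t\<^sup>2) powr ((q - 1) * a / 2))
      \<le> 1/2 * (y powr q * t powr (q * a)) + L * c1 powr q * z powr q + (L * c2 powr q + 1/2) * y powr q"
      using 1 2 unfolding sq1 by (simp add: algebra_simps)
  qed (use L c in \<open>auto intro: add_nonneg_pos\<close>)
qed

section \<open>The weight and the cutoff functions\<close>

lemma weight_has_derivative:
  fixes b :: real
  shows "((\<lambda>t. (1 + t\<^sup>2) powr b) has_real_derivative 2 * b * t * (1 + t\<^sup>2) powr (b - 1)) (at t)"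
    and "continuous_on UNIV (\<lambda>t::real. 2 * b * t * (1 + t\<^sup>2) powr (b - 1))"
    and "0 \<le> b \<Longrightarrow> \<bar>2 * b * t * (1 + t\<^sup>2) powr (b - 1)\<bar> \<le> 2 * b * (1 + t\<^sup>2) powr b"
proof -
  have pos: "1 + t\<^sup>2 > 0" for t :: real by (simp add: add_pos_nonneg)
  have "((\<lambda>t. 1 + t\<^sup>2) has_real_derivative 2 * t) (at t)"
    by (auto intro!: derivative_eq_intros)
  from DERIV_chain2[OF has_real_derivative_powr[OF pos] this]
  show "((\<lambda>t. (1 + t\<^sup>2) powr b) has_real_derivative 2 * b * t * (1 + t\<^sup>2) powr (b - 1)) (at t)"
    by (simp add: mult_ac)
  have "(1 + t\<^sup>2) \<noteq> 0" for t :: real using pos[of t] by simp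
  then show "continuous_on UNIV (\<lambda>t::real. 2 * b * t * (1 + t\<^sup>2) powr (b - 1))"
    by (intro continuous_intros) auto
  assume b: "0 \<le> b"
  \<comment> \<open>This makes the derivative of the weight at most \<open>2 * b\<close> times the
    weight itself, so differentiating it produces only a zero-order term in
    \<open>f\<close>.\<close>
  have "\<bar>t\<bar> \<le> 1 + t\<^sup>2"
    using zero_le_power2[of "\<bar>t\<bar> - 1"] zero_le_power2[of t] unfolding power2_diff by simp
  then have "\<bar>t\<bar> * (1 + t\<^sup>2) powr (b - 1) \<le> (1 + t\<^sup>2) * (1 + t\<^sup>2) powr (b - 1)"
    by (intro mult_right_mono) auto
  also have "\<dots> = (1 + t\<^sup>2) powr b"
    using powr_add[of "1 + t\<^sup>2" 1 "b - 1"] pos[of t] by simp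
  finally show "\<bar>2 * b * t * (1 + t\<^sup>2) powr (b - 1)\<bar> \<le> 2 * b * (1 + t\<^sup>2) powr b"
    using b mult_left_mono[of _ _ "2 * b"] by (simp add: abs_mult mult.assoc)
qed

text \<open>The square makes the cutoff continuously differentiable at the edge of its support,
  where a piecewise linear one would have a kink and the chain rule would not apply.\<close>

definition cutoff :: "real \<Rightarrow> real \<Rightarrow> real" where
  "cutoff r t = max 0 (1 - t\<^sup>2 / r\<^sup>2) powr 2"

definition cutoff_deriv :: "real \<Rightarrow> real \<Rightarrow> real" where
  "cutoff_deriv r t = 2 * max 0 (1 - t\<^sup>2 / r\<^sup>2) powr 1 * (- 2 * t / r\<^sup>2)"

lemma cutoff_has_derivative: "(cutoff r has_real_derivative cutoff_deriv r t) (at t)"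
proof -
  have "((\<lambda>t. 1 - t\<^sup>2 / r\<^sup>2) has_real_derivative - 2 * t / r\<^sup>2) (at t)"
    unfolding divide_inverse by (auto intro!: derivative_eq_intros)
  from DERIV_chain2[OF max_powr_has_derivative[of 2] this]
  show ?thesis by (simp add: cutoff_def[abs_def] cutoff_deriv_def)
qed

lemma continuous_on_cutoff_deriv: "continuous_on UNIV (cutoff_deriv r)"
  unfolding cutoff_deriv_def[abs_def] divide_inverse
  by (intro continuous_intros continuous_on_max_powr) auto

lemma cutoff_bounds: "0 \<le> cutoff r t" "cutoff r t \<le> 1"
  by (auto simp: cutoff_def intro!: power_le_one)

lemma cutoff_eq_0: "0 < r \<Longrightarrow> r < t \<Longrightarrow> cutoff r t = 0"
  using power_strict_mono[of r t 2] by (simp add: cutoff_def max_def field_simps)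

text \<open>For \<open>|t| \<le> r\<close> and \<open>1 \<le> r\<close> the quotient
  \<open>|t| / r^2\<close> is at most \<open>1\<close>. Uniformity in \<open>r\<close> keeps the
  contribution of the cutoffs to the gradients bounded as \<open>r\<close> grows.\<close>

lemma cutoff_deriv_le:
  assumes "1 \<le> r" shows "\<bar>cutoff_deriv r t\<bar> \<le> 4"
proof (cases "\<bar>t\<bar> \<le> r")
  case True
  have "\<bar>t\<bar> / r\<^sup>2 \<le> 1"
    using True assms self_le_power[of r 2] by simp
  moreover have "max 0 (1 - t\<^sup>2 / r\<^sup>2) \<le> 1" by simp
  ultimately have "max 0 (1 - t\<^sup>2 / r\<^sup>2) * (\<bar>t\<bar> / r\<^sup>2) \<le> 1 * 1"
    by (intro mult_mono) auto
  then show ?thesis by (simp add: cutoff_deriv_def abs_mult)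
next
  case False
  then have "r\<^sup>2 < t\<^sup>2" using assms power_strict_mono[of r "\<bar>t\<bar>" 2] by simp
  then show ?thesis using assms by (simp add: cutoff_deriv_def max_def field_simps)
qed

lemma cutoff_mono: "0 < r \<Longrightarrow> r \<le> r' \<Longrightarrow> cutoff r t \<le> cutoff r' t"
  unfolding cutoff_def by (intro powr_mono2 max.mono diff_left_mono divide_left_mono power_mono) auto

lemma cutoff_tendsto: "(\<lambda>n. cutoff (real (Suc n)) t) \<longlonglongrightarrow> 1"
proof -
  have "(\<lambda>n. 1 - t\<^sup>2 * (inverse (real (Suc n)))\<^sup>2) \<longlonglongrightarrow> 1 - t\<^sup>2 * 0\<^sup>2"
    by (intro tendsto_intros LIMSEQ_inverse_real_of_nat)
  then have "(\<lambda>n. max 0 (1 - t\<^sup>2 / (real (Suc n))\<^sup>2)) \<longlonglongrightarrow> max 0 1"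
    by (intro tendsto_max) (simp_all add: divide_inverse power_inverse)
  then have "(\<lambda>n. max 0 (1 - t\<^sup>2 / (real (Suc n))\<^sup>2) powr 2) \<longlonglongrightarrow> 1 powr 2"
    by (intro tendsto_powr) auto
  then show ?thesis by (simp add: cutoff_def)
qed

lemma powr_add_le:
  fixes x y q :: real
  assumes "0 \<le> x" "0 \<le> y" "0 \<le> q"
  shows "(x + y) powr q \<le> 2 powr q * (x powr q + y powr q)"
proof -
  have "(x + y) powr q \<le> (2 * max x y) powr q"
    using assms by (intro powr_mono2) auto
  also have "\<dots> = 2 powr q * max x y powr q" using assms by (simp add: powr_mult)
  also have "\<dots> \<le> 2 powr q * (x powr q + y powr q)"
    by (intro mult_left_mono) (auto simp: max_def)
  finally show ?thesis .
qed

lemma has_gradient_measurable: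
  assumes "has_gradient X f G"
  shows "G \<in> borel_measurable borel"
proof -
  have "(\<lambda>x. G x \<bullet> b) \<in> borel_measurable borel" if "b \<in> Basis" for b
  proof -
    obtain i where "b = axis i 1" using \<open>b \<in> Basis\<close> by (auto simp: Basis_vec_def)
    then show ?thesis using assms by (simp add: has_gradient_def Linf_loc_def inner_axis)
  qed
  then show ?thesis using borel_measurable_euclidean_space by blast
qed

lemma nn_integral_linear_combination:
  fixes f g h :: "'a \<Rightarrow> real"
  assumes [measurable]: "f \<in> borel_measurable M" "g \<in> borel_measurable M" "h \<in> borel_measurable M"
    and "0 \<le> a" "0 \<le> b" "0 \<le> c" "\<And>x. 0 \<le> f x" "\<And>x. 0 \<le> g x" "\<And>x. 0 \<le> h x"
  shows "(\<integral>\<^sup>+x. ennreal (a * f x + b * g x + c * h x) \<partial>M) =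
    ennreal a * (\<integral>\<^sup>+x. ennreal (f x) \<partial>M) + ennreal b * (\<integral>\<^sup>+x. ennreal (g x) \<partial>M)
      + ennreal c * (\<integral>\<^sup>+x. ennreal (h x) \<partial>M)"
  using assms by (simp add: ennreal_plus ennreal_mult nn_integral_add nn_integral_cmult)

text \<open>Finiteness of \<open>I\<close> is essential: \<open>I = \<infinity>\<close> satisfies
  the second assumption for every \<open>B\<close>.\<close>

lemma ennreal_absorb_half:
  fixes I B :: ennreal
  assumes "I < \<infinity>" "I \<le> ennreal (1/2) * I + B"
  shows "I \<le> ennreal 2 * B"
proof (cases B)
  case (real b)
  obtain i where i: "I = ennreal i" "0 \<le> i"
    using assms(1) by (cases I) auto
  have "ennreal (1/2 * i + b) = ennreal (1/2 * i) + ennreal b"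
    using i(2) real(1) by (intro ennreal_plus) auto
  also have "ennreal (1/2 * i) = ennreal (1/2) * ennreal i"
    by (rule ennreal_mult') simp
  finally have "ennreal (1/2 * i + b) = ennreal (1/2) * ennreal i + ennreal b" .
  then have "ennreal i \<le> ennreal (1/2 * i + b)"
    using assms(2) unfolding i(1) real(2) by (simp only:)
  then have "i \<le> 1/2 * i + b" using i(2) real(1) by (subst (asm) ennreal_le_iff) auto
  then have "ennreal i \<le> ennreal (2 * b)" by (intro ennreal_leI) simp
  then show ?thesis unfolding i(1) real(2) by (subst (asm) ennreal_mult') simp_all
next
  case top
  then show ?thesis by (simp add: ennreal_mult_top)
qed

section \<open>Absorption on compact supports and exhaustion by balls\<close>

locale u_bound =
  fixes X :: "'k::finite \<Rightarrow> real ^ 'n \<Rightarrow> real ^ 'n"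
    and d :: "real ^ 'n \<Rightarrow> real" and Dd :: "real ^ 'n \<Rightarrow> real ^ 'k"
    and \<mu> :: "(real ^ 'n) measure" and a C D :: real
  assumes X: "\<And>i. smooth (X i)" "\<And>i x. divergence (X i) x = 0"
    and d_nonneg: "\<And>x. 0 \<le> d x" and d_cont: "continuous_on UNIV d"
    and d_grad: "has_gradient X d Dd" and d_grad_le: "AE x in lborel. norm (Dd x) \<le> 1"
    and d_balls: "\<And>R. compact {x. d x \<le> R}"
    and a: "0 < a" and mu_prob: "prob_space \<mu>" and mu_sets: "sets \<mu> = sets borel"
    and mu_ac: "absolutely_continuous lborel \<mu>"
    and CD: "0 < C" "0 < D"
    and bound: "\<And>f G. f \<in> class_L X \<Longrightarrow> has_gradient X f G \<Longrightarrow>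
      (\<integral>\<^sup>+x. ennreal (\<bar>f x\<bar> * d x powr a) \<partial>\<mu>)
        \<le> ennreal C * (\<integral>\<^sup>+x. ennreal (norm (G x)) \<partial>\<mu>) + ennreal D * (\<integral>\<^sup>+x. ennreal \<bar>f x\<bar> \<partial>\<mu>)"
begin

lemma measurable_mu: "f \<in> borel_measurable borel \<Longrightarrow> f \<in> borel_measurable \<mu>"
  using mu_sets measurable_cong_sets by blast

text \<open>Gradients are determined up to Lebesgue-null sets, while the estimates are integrated
  against \<open>\<mu>\<close>; absolute continuity transfers the null set.\<close>

lemma d_grad_le_mu: "AE x in \<mu>. norm (Dd x) \<le> 1"
  using absolutely_continuous_AE[OF _ mu_ac d_grad_le] mu_sets by simp

text \<open>The constants are fixed before \<open>f\<close>, \<open>G\<close> and \<open>r\<close>,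
  so they survive letting the support grow. Compact support serves only to make the left-hand side
  finite.\<close>

lemma compact_support_bound:
  assumes q: "1 < q"
  obtains K1 K2 where "K1 > 0" "K2 > 0"
    "\<And>f G r. continuous_on UNIV f \<Longrightarrow> has_gradient X f G \<Longrightarrow> (\<And>x. r < d x \<Longrightarrow> f x = 0) \<Longrightarrow>
      (\<integral>\<^sup>+x. ennreal (\<bar>f x\<bar> powr q * d x powr (q * a)) \<partial>\<mu>)
        \<le> ennreal K1 * (\<integral>\<^sup>+x. ennreal (norm (G x) powr q) \<partial>\<mu>)
          + ennreal K2 * (\<integral>\<^sup>+x. ennreal (\<bar>f x\<bar> powr q) \<partial>\<mu>)"
proof -
  interpret prob_space \<mu> by (rule mu_prob)
  define b where "b = (q - 1) * a / 2"
  have b: "0 < b" using q a by (simp add: b_def)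
  define w where "w t = (1 + t\<^sup>2) powr b" for t :: real
  define w' where "w' t = 2 * b * t * (1 + t\<^sup>2) powr (b - 1)" for t :: real
  have w: "(w has_real_derivative w' t) (at t)" "continuous_on UNIV w'" "\<bar>w' t\<bar> \<le> 2 * b * w t" "0 \<le> w t" for t
    using weight_has_derivative[of b] b by (auto simp: w_def[abs_def] w'_def[abs_def])
  have wd: "d x powr ((q - 1) * a) \<le> w (d x)" for x
  proof -
    have "d x powr ((q - 1) * a) = (d x powr 2) powr b" by (simp add: powr_powr b_def)
    also have "\<dots> = ((d x)\<^sup>2) powr b"
      using d_nonneg[of x] by (cases "d x = 0") (simp_all add: powr_numeral)
    also have "\<dots> \<le> w (d x)" unfolding w_def using b by (intro powr_mono2) auto
    finally show ?thesis .
  qed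
  \<comment> \<open>The coefficient \<open>C * q\<close> comes from differentiating
    \<open>|f| powr q\<close>, \<open>C * (2 * b)\<close> from differentiating the weight, and
    \<open>D\<close> from the zero-order term of the hypothesis.\<close>
  obtain K1 K2 where K: "K1 > 0" "K2 > 0"
    "\<And>y z t. 0 \<le> y \<Longrightarrow> 0 \<le> z \<Longrightarrow> 0 \<le> t \<Longrightarrow>
      (C * q) * (y powr (q - 1) * (1 + t\<^sup>2) powr ((q - 1) * a / 2) * z)
        + (C * (2 * b) + D) * (y powr q * (1 + t\<^sup>2) powr ((q - 1) * a / 2))
      \<le> 1/2 * (y powr q * t powr (q * a)) + K1 * z powr q + K2 * y powr q"
    using absorption_bound[OF a q, of "C * q" "C * (2 * b) + D"] CD q b
    by (smt (verit) mult_pos_pos)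
  show thesis
  proof (rule that[of "2 * K1" "2 * K2"])
    fix f G r
    assume f: "continuous_on UNIV f" and G: "has_gradient X f G" and z: "\<And>x. r < d x \<Longrightarrow> f x = 0"
    define F' where "F' t = q * (max 0 t powr (q - 1) - max 0 (- t) powr (q - 1))" for t :: real
    have F': "((\<lambda>t. \<bar>t\<bar> powr q) has_real_derivative F' t) (at t)" for t
      unfolding F'_def by (rule abs_powr_has_derivative[OF q])
    have cF': "continuous_on UNIV F'"
      unfolding F'_def[abs_def] using q by (intro continuous_intros continuous_on_max_powr) auto
    have aF': "\<bar>F' t\<bar> = q * \<bar>t\<bar> powr (q - 1)" for t
      using q by (cases "0 \<le> t") (auto simp: F'_def abs_mult max_absorb1 max_absorb2)
    define \<Phi> where "\<Phi> x = \<bar>f x\<bar> powr q * w (d x)" for x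
    define H where "H x = w (d x) *\<^sub>R F' (f x) *\<^sub>R G x + \<bar>f x\<bar> powr q *\<^sub>R w' (d x) *\<^sub>R Dd x" for x
    have cont: "continuous_on UNIV (\<lambda>x. \<bar>f x\<bar> powr q)" "continuous_on UNIV (\<lambda>x. w (d x))"
      using DERIV_continuous_on[OF F'] DERIV_continuous_on[OF w(1)] f d_cont
        continuous_on_compose2[of UNIV "\<lambda>t. \<bar>t\<bar> powr q" UNIV f] continuous_on_compose2[of UNIV w UNIV d]
      by auto
    have H: "has_gradient X \<Phi> H"
      unfolding \<Phi>_def[abs_def] H_def[abs_def]
      by (rule has_gradient_mult[OF X cont(1) has_gradient_chain[OF X f G F' cF']
            cont(2) has_gradient_chain[OF X d_cont d_grad w(1,2)]])
    have "\<Phi> \<in> class_L X"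
      using H cont unfolding class_L_def \<Phi>_def[abs_def] by (auto intro!: continuous_intros)
    note U = bound[OF this H]
    let ?A = "\<lambda>x. \<bar>f x\<bar> powr q * d x powr (q * a)"
    have [measurable]: "f \<in> borel_measurable \<mu>" "d \<in> borel_measurable \<mu>" "G \<in> borel_measurable \<mu>"
        "H \<in> borel_measurable \<mu>" "\<Phi> \<in> borel_measurable \<mu>"
      using f d_cont has_gradient_measurable[OF G] has_gradient_measurable[OF H] cont
      by (auto intro!: measurable_mu borel_measurable_continuous_onI continuous_intros simp: \<Phi>_def[abs_def])
    have le1: "?A x \<le> \<bar>\<Phi> x\<bar> * d x powr a" for x
    proof -
      have "?A x = \<bar>f x\<bar> powr q * d x powr ((q - 1) * a) * d x powr a"
        using powr_add[of "d x" "(q - 1) * a" a] by (simp add: algebra_simps)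
      also have "\<dots> \<le> \<bar>f x\<bar> powr q * w (d x) * d x powr a"
        by (intro mult_right_mono mult_left_mono wd) auto
      finally show ?thesis using w(4) by (simp add: \<Phi>_def abs_mult)
    qed
    have le2: "AE x in \<mu>. C * norm (H x) + D * \<bar>\<Phi> x\<bar> \<le> 1/2 * ?A x + K1 * norm (G x) powr q + K2 * \<bar>f x\<bar> powr q"
      using d_grad_le_mu
    proof eventually_elim
      case (elim x)
      let ?y = "\<bar>f x\<bar>" and ?W = "w (d x)"
      have "norm (\<bar>f x\<bar> powr q *\<^sub>R w' (d x) *\<^sub>R Dd x) \<le> ?y powr q * (2 * b * ?W * 1)"
        using w(3)[of "d x"] elim unfolding norm_scaleR abs_of_nonneg[OF powr_ge_zero]
        by (intro mult_left_mono mult_mono) (auto intro: order_trans[OF abs_ge_zero])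
      moreover have "norm (w (d x) *\<^sub>R F' (f x) *\<^sub>R G x) = ?W * (q * ?y powr (q - 1) * norm (G x))"
        using w(4)[of "d x"] by (simp add: abs_mult aF')
      ultimately have "norm (H x) \<le> ?W * (q * ?y powr (q - 1) * norm (G x)) + ?y powr q * (2 * b * ?W)"
        unfolding H_def by (intro order_trans[OF norm_triangle_ineq]) linarith
      then have "C * norm (H x) + D * \<bar>\<Phi> x\<bar>
          \<le> C * (?W * (q * ?y powr (q - 1) * norm (G x)) + ?y powr q * (2 * b * ?W)) + D * (?y powr q * ?W)"
        using CD w(4) by (simp add: \<Phi>_def abs_mult)
      also have "\<dots> = (C * q) * (?y powr (q - 1) * ?W * norm (G x)) + (C * (2 * b) + D) * (?y powr q * ?W)"
        by (simp add: algebra_simps)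
      also have "\<dots> \<le> 1/2 * ?A x + K1 * norm (G x) powr q + K2 * \<bar>f x\<bar> powr q"
        using K(3)[of ?y "norm (G x)" "d x"] d_nonneg[of x] by (simp add: w_def b_def)
      finally show ?case .
    qed
    let ?I = "\<integral>\<^sup>+x. ennreal (?A x) \<partial>\<mu>"
    let ?J = "\<integral>\<^sup>+x. ennreal (norm (G x) powr q) \<partial>\<mu>"
    let ?L = "\<integral>\<^sup>+x. ennreal (\<bar>f x\<bar> powr q) \<partial>\<mu>"
    have "?I \<le> (\<integral>\<^sup>+x. ennreal (\<bar>\<Phi> x\<bar> * d x powr a) \<partial>\<mu>)"
      by (intro nn_integral_mono ennreal_leI le1)
    also have "\<dots> \<le> ennreal C * (\<integral>\<^sup>+x. ennreal (norm (H x)) \<partial>\<mu>) + ennreal D * (\<integral>\<^sup>+x. ennreal \<bar>\<Phi> x\<bar> \<partial>\<mu>)"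
      by (rule U)
    also have "\<dots> = (\<integral>\<^sup>+x. ennreal (C * norm (H x) + D * \<bar>\<Phi> x\<bar>) \<partial>\<mu>)"
      using CD by (simp add: nn_integral_add nn_integral_cmult ennreal_plus ennreal_mult')
    also have "\<dots> \<le> (\<integral>\<^sup>+x. ennreal (1/2 * ?A x + K1 * norm (G x) powr q + K2 * \<bar>f x\<bar> powr q) \<partial>\<mu>)"
      by (rule nn_integral_mono_AE[OF AE_mp[OF le2 AE_I2]]) (intro impI ennreal_leI)
    also have "\<dots> = ennreal (1/2) * ?I + ennreal K1 * ?J + ennreal K2 * ?L"
      using K by (intro nn_integral_linear_combination) auto
    finally have main: "?I \<le> ennreal (1/2) * ?I + ennreal K1 * ?J + ennreal K2 * ?L" .
    \<comment> \<open>The integrand is continuous and vanishes outside the compact ball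
      \<open>{x. d x \<le> r}\<close>, hence is bounded, and \<open>\<mu>\<close> is a probability
      measure.\<close>
    have fin: "?I < \<infinity>"
    proof -
      have "continuous_on UNIV (\<lambda>x. max 0 (d x) powr (q * a))"
        using q a d_cont by (intro continuous_on_max_powr) auto
      then have cA: "continuous_on UNIV ?A"
        using cont(1) d_nonneg by (simp add: max_absorb2 continuous_on_mult)
      have "bounded (?A ` {x. d x \<le> r})"
        by (intro compact_imp_bounded compact_continuous_image continuous_on_subset[OF cA] d_balls) auto
      then obtain B where "\<And>x. d x \<le> r \<Longrightarrow> \<bar>?A x\<bar> \<le> B"
        unfolding bounded_iff by auto
      then have "?A x \<le> \<bar>B\<bar>" for x
        using z[of x] by (cases "d x \<le> r") (auto intro: order_trans[OF _ abs_ge_self])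
      then have "?I \<le> (\<integral>\<^sup>+x. ennreal \<bar>B\<bar> \<partial>\<mu>)"
        by (intro nn_integral_mono ennreal_leI)
      also have "\<dots> < \<infinity>" by (simp add: emeasure_space_1)
      finally show ?thesis .
    qed
    show "?I \<le> ennreal (2 * K1) * ?J + ennreal (2 * K2) * ?L"
    proof -
      have "?I \<le> ennreal 2 * (ennreal K1 * ?J + ennreal K2 * ?L)"
        by (rule ennreal_absorb_half[OF fin]) (use main in \<open>simp only: add.assoc\<close>)
      then show ?thesis
        using K by (simp add: distrib_left ennreal_mult mult.assoc del: ennreal_numeral)
    qed
  qed (use K in auto)
qed

lemma power_bound:
  assumes q: "1 < q"
  shows "\<exists>Cq>0. \<exists>Dq>0. \<forall>f\<in>class_L X. \<forall>G. has_gradient X f G \<longrightarrow>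
      (\<integral>\<^sup>+x. ennreal (\<bar>f x\<bar> powr q * d x powr (q * a)) \<partial>\<mu>)
        \<le> ennreal Cq * (\<integral>\<^sup>+x. ennreal (norm (G x) powr q) \<partial>\<mu>)
          + ennreal Dq * (\<integral>\<^sup>+x. ennreal (\<bar>f x\<bar> powr q) \<partial>\<mu>)"
proof -
  obtain K1 K2 where K: "K1 > 0" "K2 > 0"
    "\<And>f G r. continuous_on UNIV f \<Longrightarrow> has_gradient X f G \<Longrightarrow> (\<And>x. r < d x \<Longrightarrow> f x = 0) \<Longrightarrow>
      (\<integral>\<^sup>+x. ennreal (\<bar>f x\<bar> powr q * d x powr (q * a)) \<partial>\<mu>)
        \<le> ennreal K1 * (\<integral>\<^sup>+x. ennreal (norm (G x) powr q) \<partial>\<mu>)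
          + ennreal K2 * (\<integral>\<^sup>+x. ennreal (\<bar>f x\<bar> powr q) \<partial>\<mu>)"
    using compact_support_bound[OF q] by blast
  \<comment> \<open>The gradient of the truncated function is at most
    \<open>|\<nabla>f| + 4 |f|\<close>, where \<open>4\<close> bounds the derivative of the cutoff;
    \<open>powr_add_le\<close> contributes \<open>2 powr q\<close>. The summand \<open>K2\<close>
    stems from the zero-order term, where the cutoff is at most \<open>1\<close>.\<close>
  define Cq where "Cq = K1 * 2 powr q"
  define Dq where "Dq = K1 * 2 powr q * 4 powr q + K2"
  have pos: "Cq > 0" "Dq > 0" using K by (auto simp: Cq_def Dq_def intro!: add_pos_pos)
  have "(\<integral>\<^sup>+x. ennreal (\<bar>f x\<bar> powr q * d x powr (q * a)) \<partial>\<mu>)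
        \<le> ennreal Cq * (\<integral>\<^sup>+x. ennreal (norm (G x) powr q) \<partial>\<mu>)
          + ennreal Dq * (\<integral>\<^sup>+x. ennreal (\<bar>f x\<bar> powr q) \<partial>\<mu>)" (is "_ \<le> ?rhs")
    if f: "continuous_on UNIV f" and G: "has_gradient X f G" for f G
  proof -
    define c where "c n x = cutoff (real (Suc n)) (d x)" for n x
    define fn where "fn n x = f x * c n x" for n x
    define Gn where "Gn n x = c n x *\<^sub>R G x + f x *\<^sub>R cutoff_deriv (real (Suc n)) (d x) *\<^sub>R Dd x" for n x
    have cc: "continuous_on UNIV (c n)" for n
      using continuous_on_compose2[OF DERIV_continuous_on[OF cutoff_has_derivative] d_cont]
      unfolding c_def[abs_def] by blast
    have c01: "0 \<le> c n x" "c n x \<le> 1" for n x by (auto simp: c_def cutoff_bounds)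
    have fc: "continuous_on UNIV (fn n)" for n
      unfolding fn_def[abs_def] using f cc by (intro continuous_intros)
    have fG: "has_gradient X (fn n) (Gn n)" for n
      unfolding fn_def[abs_def] Gn_def[abs_def]
      by (rule has_gradient_mult[OF X f G cc])
        (use has_gradient_chain[OF X d_cont d_grad cutoff_has_derivative continuous_on_cutoff_deriv]
          in \<open>simp add: c_def[abs_def]\<close>)
    have fz: "fn n x = 0" if "real (Suc n) < d x" for n x
      using that cutoff_eq_0[of "real (Suc n)" "d x"] by (simp add: fn_def c_def)
    have [measurable]: "f \<in> borel_measurable \<mu>" "d \<in> borel_measurable \<mu>" "G \<in> borel_measurable \<mu>"
        "c n \<in> borel_measurable \<mu>" for n
      using f d_cont has_gradient_measurable[OF G] cc
      by (auto intro!: measurable_mu borel_measurable_continuous_onI)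
    let ?h = "\<lambda>x. \<bar>f x\<bar> powr q * d x powr (q * a)"
    have bd: "(\<integral>\<^sup>+x. ennreal (\<bar>fn n x\<bar> powr q * d x powr (q * a)) \<partial>\<mu>) \<le> ?rhs" for n
    proof -
      have "AE x in \<mu>. norm (Gn n x) powr q \<le> 2 powr q * norm (G x) powr q + 2 powr q * 4 powr q * \<bar>f x\<bar> powr q"
        using d_grad_le_mu
      proof eventually_elim
        case (elim x)
        have "norm (f x *\<^sub>R cutoff_deriv (real (Suc n)) (d x) *\<^sub>R Dd x) \<le> \<bar>f x\<bar> * (4 * 1)"
          unfolding norm_scaleR using elim by (intro mult_left_mono mult_mono cutoff_deriv_le) auto
        moreover have "norm (c n x *\<^sub>R G x) \<le> norm (G x)"
          using c01[of n x] by (simp add: mult_left_le_one_le)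
        ultimately have "norm (Gn n x) \<le> norm (G x) + 4 * \<bar>f x\<bar>"
          unfolding Gn_def by (intro order_trans[OF norm_triangle_ineq]) linarith
        then have "norm (Gn n x) powr q \<le> (norm (G x) + 4 * \<bar>f x\<bar>) powr q"
          using q by (intro powr_mono2) auto
        also have "\<dots> \<le> 2 powr q * (norm (G x) powr q + (4 * \<bar>f x\<bar>) powr q)"
          using q by (intro powr_add_le) auto
        finally show ?case by (simp add: powr_mult algebra_simps)
      qed
      then have "(\<integral>\<^sup>+x. ennreal (norm (Gn n x) powr q) \<partial>\<mu>)
          \<le> (\<integral>\<^sup>+x. ennreal (2 powr q * norm (G x) powr q + 2 powr q * 4 powr q * \<bar>f x\<bar> powr q) \<partial>\<mu>)"
        by (rule nn_integral_mono_AE[OF AE_mp[OF _ AE_I2]]) (intro impI ennreal_leI)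
      also have "\<dots> = ennreal (2 powr q) * (\<integral>\<^sup>+x. ennreal (norm (G x) powr q) \<partial>\<mu>)
          + ennreal (2 powr q * 4 powr q) * (\<integral>\<^sup>+x. ennreal (\<bar>f x\<bar> powr q) \<partial>\<mu>)"
        by (simp add: nn_integral_add nn_integral_cmult ennreal_plus ennreal_mult')
      finally have g: "(\<integral>\<^sup>+x. ennreal (norm (Gn n x) powr q) \<partial>\<mu>) \<le> \<dots>" .
      have l: "(\<integral>\<^sup>+x. ennreal (\<bar>fn n x\<bar> powr q) \<partial>\<mu>) \<le> (\<integral>\<^sup>+x. ennreal (\<bar>f x\<bar> powr q) \<partial>\<mu>)"
      proof (intro nn_integral_mono ennreal_leI powr_mono2)
        show "\<bar>fn n x\<bar> \<le> \<bar>f x\<bar>" for x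
          using c01[of n x] by (simp add: fn_def abs_mult mult_left_le)
      qed (use q in auto)
      have "(\<integral>\<^sup>+x. ennreal (\<bar>fn n x\<bar> powr q * d x powr (q * a)) \<partial>\<mu>)
          \<le> ennreal K1 * (\<integral>\<^sup>+x. ennreal (norm (Gn n x) powr q) \<partial>\<mu>)
          + ennreal K2 * (\<integral>\<^sup>+x. ennreal (\<bar>fn n x\<bar> powr q) \<partial>\<mu>)"
        by (rule K(3)[OF fc fG fz])
      also have "\<dots> \<le> ennreal K1 * (ennreal (2 powr q) * (\<integral>\<^sup>+x. ennreal (norm (G x) powr q) \<partial>\<mu>)
          + ennreal (2 powr q * 4 powr q) * (\<integral>\<^sup>+x. ennreal (\<bar>f x\<bar> powr q) \<partial>\<mu>))
          + ennreal K2 * (\<integral>\<^sup>+x. ennreal (\<bar>f x\<bar> powr q) \<partial>\<mu>)"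
        by (intro add_mono mult_left_mono g l) auto
      also have "\<dots> = ?rhs"
        using K by (simp add: Cq_def Dq_def ennreal_plus ennreal_mult' distrib_left distrib_right mult.assoc add.assoc)
      finally show ?thesis .
    qed
    \<comment> \<open>Only the left-hand side needs a limit, since \<open>?rhs\<close> already
      bounds every truncated integral; this holds trivially if \<open>?rhs\<close> is
      infinite.\<close>
    have "(\<lambda>n. \<integral>\<^sup>+x. ennreal (\<bar>fn n x\<bar> powr q * d x powr (q * a)) \<partial>\<mu>) \<longlonglongrightarrow> (\<integral>\<^sup>+x. ennreal (?h x) \<partial>\<mu>)"
    proof (rule nn_integral_LIMSEQ)
      show "(\<lambda>x. ennreal (\<bar>fn n x\<bar> powr q * d x powr (q * a))) \<in> borel_measurable \<mu>" for n
        unfolding fn_def by measurable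
      show "incseq (\<lambda>n x. ennreal (\<bar>fn n x\<bar> powr q * d x powr (q * a)))"
      proof (intro incseq_SucI le_funI ennreal_leI mult_right_mono powr_mono2)
        show "\<bar>fn n x\<bar> \<le> \<bar>fn (Suc n) x\<bar>" for n x
          using cutoff_mono[of "real (Suc n)" "real (Suc (Suc n))" "d x"] c01
          by (simp add: fn_def abs_mult mult_left_mono c_def)
      qed (use q in auto)
      fix x
      have "(\<lambda>n. c n x) \<longlonglongrightarrow> 1" unfolding c_def by (rule cutoff_tendsto)
      then have "(\<lambda>n. \<bar>f x * c n x\<bar>) \<longlonglongrightarrow> \<bar>f x * 1\<bar>" by (intro tendsto_intros)
      then have "(\<lambda>n. \<bar>fn n x\<bar> powr q) \<longlonglongrightarrow> \<bar>f x\<bar> powr q"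
        using q by (intro tendsto_powr') (auto simp: fn_def)
      then show "(\<lambda>n. ennreal (\<bar>fn n x\<bar> powr q * d x powr (q * a))) \<longlonglongrightarrow> ennreal (?h x)"
        by (intro tendsto_ennrealI tendsto_mult_right)
    qed
    then show ?thesis by (rule LIMSEQ_le_const2) (use bd in blast)
  qed
  then show ?thesis using pos unfolding class_L_def by blast
qed

end

theorem theorem2p3:
  fixes X :: "'k::finite \<Rightarrow> real ^ 'n \<Rightarrow> real ^ 'n"
    and \<rho> :: "real ^ 'n \<Rightarrow> real ^ 'n \<Rightarrow> real"
    and d :: "real ^ 'n \<Rightarrow> real"
    and Dd :: "real ^ 'n \<Rightarrow> real ^ 'k"
    and \<mu> :: "(real ^ 'n) measure"
    and p :: real
  assumes X_smooth: "\<And>i. smooth (X i)"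
    and X_div: "\<And>i x. divergence (X i) x = 0"
    and metric: "Metric_space UNIV \<rho>"
    and d_def: "\<And>x. d x = \<rho> 0 x"
    and d_L: "d \<in> class_L X"
    and d_grad: "has_gradient X d Dd"
    and d_grad_le: "AE x in lborel. norm (Dd x) \<le> 1"
    and d_balls: "\<And>R. compact {x. d x \<le> R}"
    and p: "1 < p"
    and mu_prob: "prob_space \<mu>"
    and mu_sets: "sets \<mu> = sets borel"
    and mu_ac: "absolutely_continuous lborel \<mu>"
    and U_bound: "\<exists>C>0. \<exists>D>0. \<forall>f\<in>class_L X. \<forall>G. has_gradient X f G \<longrightarrow>
      (\<integral>\<^sup>+x. ennreal (\<bar>f x\<bar> * d x powr (p - 1)) \<partial>\<mu>)
        \<le> ennreal C * (\<integral>\<^sup>+x. ennreal (norm (G x)) \<partial>\<mu>)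
          + ennreal D * (\<integral>\<^sup>+x. ennreal \<bar>f x\<bar> \<partial>\<mu>)"
  shows "\<forall>q\<ge>1. \<exists>Cq>0. \<exists>Dq>0. \<forall>f\<in>class_L X. \<forall>G. has_gradient X f G \<longrightarrow>
      (\<integral>\<^sup>+x. ennreal (\<bar>f x\<bar> powr q * d x powr (q * (p - 1))) \<partial>\<mu>)
        \<le> ennreal Cq * (\<integral>\<^sup>+x. ennreal (norm (G x) powr q) \<partial>\<mu>)
          + ennreal Dq * (\<integral>\<^sup>+x. ennreal (\<bar>f x\<bar> powr q) \<partial>\<mu>)"
proof (intro allI impI)
  fix q :: real assume q: "1 \<le> q"
  show "\<exists>Cq>0. \<exists>Dq>0. \<forall>f\<in>class_L X. \<forall>G. has_gradient X f G \<longrightarrow>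
      (\<integral>\<^sup>+x. ennreal (\<bar>f x\<bar> powr q * d x powr (q * (p - 1))) \<partial>\<mu>)
        \<le> ennreal Cq * (\<integral>\<^sup>+x. ennreal (norm (G x) powr q) \<partial>\<mu>)
          + ennreal Dq * (\<integral>\<^sup>+x. ennreal (\<bar>f x\<bar> powr q) \<partial>\<mu>)"
  \<comment> \<open>For \<open>q = 1\<close> the hypothesis is already the claim, while the argument
    for larger exponents would fail because \<open>|t|\<close> is not differentiable at
    \<open>0\<close>.\<close>
  proof (cases "q = 1")
    case True
    then show ?thesis using U_bound by simp
  next
    case False
    obtain C D where CD: "C > 0" "D > 0" "\<forall>f\<in>class_L X. \<forall>G. has_gradient X f G \<longrightarrow>
      (\<integral>\<^sup>+x. ennreal (\<bar>f x\<bar> * d x powr (p - 1)) \<partial>\<mu>)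
        \<le> ennreal C * (\<integral>\<^sup>+x. ennreal (norm (G x)) \<partial>\<mu>) + ennreal D * (\<integral>\<^sup>+x. ennreal \<bar>f x\<bar> \<partial>\<mu>)"
      using U_bound by blast
    have "0 \<le> d x" for x
      unfolding d_def by (rule Metric_space.nonneg[OF metric])
    moreover have "continuous_on UNIV d" using d_L by (simp add: class_L_def)
    moreover have "(\<integral>\<^sup>+x. ennreal (\<bar>f x\<bar> * d x powr (p - 1)) \<partial>\<mu>)
        \<le> ennreal C * (\<integral>\<^sup>+x. ennreal (norm (G x)) \<partial>\<mu>) + ennreal D * (\<integral>\<^sup>+x. ennreal \<bar>f x\<bar> \<partial>\<mu>)"
      if "f \<in> class_L X" "has_gradient X f G" for f G
      using CD(3) that by blast
    moreover have "0 < p - 1" using p by simp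
    ultimately interpret u_bound X d Dd \<mu> "p - 1" C D
      by (intro u_bound.intro X_smooth X_div d_grad d_grad_le d_balls mu_prob mu_sets mu_ac CD)
    show ?thesis using power_bound q False by simp
  qed
qed

end
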